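(* For integers $b\ge0$ and $n\ge1$, the number $jp_b(n)$ of multiplex juggling patterns with exactly $b$ balls and minimal period $n$ is \[ jp_b(n)=\frac1n\sum_{d\mid n}\mu\!\left(\tfrac{n}{d}\right)\left(\operatorname{trace}(A_b^d)-\sum_{i=0}^{b-1}\operatorname{trace}(A_i^d)\right), \] where $\mu$ is the M\"obius function.
   Context: For an integer $b\ge 0$, an ordered partition of $b$ is a finite sequence $(q_1,\ldots,q_k)$ of positive integers summing to $b$ (for $b=0$ the only one is the empty sequence). An ordered partition $(q_1,\ldots,q_k)$ with $k\ge1$ is nontrivially embedded into an ordered partition $(r_1,\ldots,r_\ell)$ by a choice of indices $1\le i_2<\cdots<i_k\le \ell$ with $q_j\le r_{i_j}$ for $2\le j\le k$; different index tuples count as different embeddings. A card for $b$ balls is either (i) a trivial card, given by an ordered partition $q$ of $b$, with left and right partitions both $q$; or (ii) a throw card, given by ordered partitions $q$ ($k\ge1$ parts) and $r$ of $b$ together with a nontrivial embedding of $q$ into $r$, with left partition $q$ and right partition $r$. Different index tuples give different cards, and a throw card is distinct from the trivial card even when $q=r$. $A_b$ is the square matrix with rows and columns indexed by the ordered partitions of $b$ whose $(u,v)$ entry is the number of cards for $b$ balls with left partition $u$ and right partition $v$. A multiplex siteswap of length $n$ is a sequence $(M_0,\ldots,M_{n-1})$, indexed by $t\in\mathbb{Z}/n\mathbb{Z}$, of finite multisets of positive integers (empty means no throw) such that for every $t$, $|M_t|$ equals the number of pairs $(s,h)$ with $h$ an element of $M_s$ (with multiplicity) and $s+h\equiv t\pmod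 n$; its number of balls is $\frac1n\sum_t\sum_{h\in M_t}h$. Its minimal period is the least $d\ge1$ with $M_{t+d}=M_t$ for all $t$. A multiplex juggling pattern with $b$ balls and minimal period $n$ is an orbit, under cyclic rotation of indices, of multiplex siteswaps of length $n$ with $b$ balls and minimal period $n$. *)

theory Defs
  imports Complex_Main "HOL-Library.Multiset" "HOL-Computational_Algebra.Squarefree"
begin

definition moebius :: "nat \<Rightarrow> int" where
  "moebius m = (if squarefree m then (-1) ^ card (prime_factors m) else 0)"

definition ord_parts :: "nat \<Rightarrow> nat list set" where
  "ord_parts b = {q. (\<forall>x\<in>set q. 0 < x) \<and> sum_list q = b}"

text \<open>Nontrivial embeddings of q = (q_1..q_k), k \<ge> 1, into r: strictly increasing
  (0-based) index lists (i_2,...,i_k) into r with q_j \<le> r_{i_j} for 2 \<le> j \<le> k.\<close>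
definition embeddings :: "nat list \<Rightarrow> nat list \<Rightarrow> nat list set" where
  "embeddings q r = {is. length is = length q - 1 \<and> sorted_wrt (<) is
      \<and> (\<forall>i\<in>set is. i < length r)
      \<and> (\<forall>j < length q - 1. q ! (j + 1) \<le> r ! (is ! j))}"

text \<open>Number of cards with left partition u and right partition v:
  one trivial card if u = v, plus one throw card per nontrivial embedding (u nonempty).\<close>
definition card_count :: "nat list \<Rightarrow> nat list \<Rightarrow> nat" where
  "card_count u v = (if u = v then 1 else 0) + (if u \<noteq> [] then card (embeddings u v) else 0)"

fun mat_pow :: "'a set \<Rightarrow> ('a \<Rightarrow> 'a \<Rightarrow> nat) \<Rightarrow> nat \<Rightarrow> 'a \<Rightarrow> 'a \<Rightarrow> nat" where
  "mat_pow S A 0 = (\<lambda>u v. if u = v then 1 else 0)"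
| "mat_pow S A (Suc n) = (\<lambda>u v. \<Sum>w\<in>S. mat_pow S A n u w * A w v)"

definition mat_trace :: "'a set \<Rightarrow> ('a \<Rightarrow> 'a \<Rightarrow> nat) \<Rightarrow> nat" where
  "mat_trace S A = (\<Sum>u\<in>S. A u u)"

definition trA :: "nat \<Rightarrow> nat \<Rightarrow> nat" where
  "trA b d = mat_trace (ord_parts b) (mat_pow (ord_parts b) card_count d)"

text \<open>Multiplex siteswaps of length n, as lists of length n of multisets of
  positive integers (index t in Z/nZ represented by t < n).\<close>
definition is_mss :: "nat \<Rightarrow> nat multiset list \<Rightarrow> bool" where
  "is_mss n M \<longleftrightarrow> length M = n \<and> (\<forall>s<n. \<forall>h\<in>#M ! s. 0 < h) \<and>
     (\<forall>t<n. size (M ! t) = (\<Sum>s<n. size (filter_mset (\<lambda>h. (s + h) mod n = t) (M ! s))))"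

definition mss_balls_eq :: "nat \<Rightarrow> nat \<Rightarrow> nat multiset list \<Rightarrow> bool" where
  "mss_balls_eq b n M \<longleftrightarrow> (\<Sum>t<n. sum_mset (M ! t)) = b * n"

definition min_period_is :: "nat \<Rightarrow> nat multiset list \<Rightarrow> bool" where
  "min_period_is n M \<longleftrightarrow> (LEAST d. 1 \<le> d \<and> (\<forall>t<n. M ! ((t + d) mod n) = M ! t)) = n"

definition patterns :: "nat \<Rightarrow> nat \<Rightarrow> nat multiset list set set" where
  "patterns b n = {range (\<lambda>k. rotate k M) | M. is_mss n M \<and> mss_balls_eq b n M \<and> min_period_is n M}"

definition jp :: "nat \<Rightarrow> nat \<Rightarrow> nat" where
  "jp b n = card (patterns b n)"

end

theory Submission
  imports Defs
begin

text \<open>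
  Record the state of a pattern at time \<open>t\<close> as the multiset of remaining flight times of its balls.
  Siteswaps of length \<open>n\<close> with \<open>b\<close> balls correspond bijectively to \<open>n\<close>-periodic sequences of such
  states. Forgetting the actual flight times and keeping only the order in which groups of balls
  land turns a state sequence into a closed walk of cards. The flight times can be
  recovered from the walk exactly if every group lands eventually. If some group never lands, then
  by monotonicity and periodicity the topmost group is carried along unchanged by every card, and
  deleting it gives an arbitrary closed walk with fewer balls. Hence the number of siteswaps of
  length \<open>d\<close> is \<open>trA b d - (\<Sum>i<b. trA i d)\<close>, and counting rotation orbits is Moebius inversion.
\<close>

text \<open>A card only expresses the landing times on its left through those on its right, so a
  walk yields a recursion that runs backwards in time and has no starting value. A landing group
  supplies one: its time is the number of steps until it is thrown, and any two solutions agree by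
  induction on that number. Only the bottom group of a card can be thrown and the order of groups is
  kept, so for a group that never lands the quantity to watch is the number of balls at or above it.
  The deleted top group has a size \<open>m\<close> with \<open>1 \<le> m \<le> b\<close>, the same
  at all times, and leaves \<open>i = b - m\<close> balls; this is the origin of the sum over
  \<open>i < b\<close>. Time runs over \<open>nat\<close> with periodicity as an equation, so that
  sequences of period \<open>d\<close> are literally among those of period \<open>n\<close> whenever
  \<open>d dvd n\<close>. Finiteness of the set of state sequences is inherited from the finitely
  many closed walks.\<close>

section \<open>Moebius inversion\<close>

lemma moebius_mult_prime:
  assumes p: "prime p" and d: "squarefree d" "\<not> p dvd d"
  shows "moebius (p * d) = - moebius d"
proof -
  have "coprime p d" using p d(2) by (simp add: prime_imp_coprime)
  then have sf: "squarefree (p * d)"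
    using squarefree_mult_coprime squarefree_prime p d(1) by blast
  have "d \<noteq> 0" "p \<noteq> 0" using d(2) p by (auto intro: Nat.gr0I)
  then have "prime_factors (p * d) = insert p (prime_factors d)"
    using p by (simp add: prime_factors_product prime_prime_factors)
  moreover have "p \<notin> prime_factors d" using d(2) by auto
  ultimately have "card (prime_factors (p * d)) = Suc (card (prime_factors d))" by simp
  then show ?thesis using sf d(1) by (simp add: moebius_def)
qed

text \<open>Divisors that are not squarefree contribute 0. For a prime \<open>p\<close> dividing
  \<open>n\<close>, multiplication by \<open>p\<close> pairs the squarefree divisors prime to
  \<open>p\<close> with the squarefree multiples of \<open>p\<close>, and the signs cancel.\<close>

lemma sum_moebius_divisors:
  fixes n :: nat
  assumes "n \<ge> 1"
  shows "(\<Sum>d | d dvd n. moebius d) = (if n = 1 then 1 else 0)"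
proof (cases "n = 1")
  case True
  then show ?thesis by (simp add: moebius_def)
next
  case False
  then obtain p where p: "prime p" "p dvd n" using prime_factor_nat by blast
  define A where "A = {d. d dvd n \<and> squarefree d \<and> \<not> p dvd d}"
  define B where "B = {d. d dvd n \<and> squarefree d \<and> p dvd d}"
  have fin: "finite {d. d dvd n}" using assms by simp
  then have finAB: "finite A" "finite B"
    by (auto simp: A_def B_def intro: finite_subset[OF _ fin])
  have "p \<noteq> 0" using p by auto
  have B: "B = (*) p ` A"
  proof (intro equalityI subsetI)
    fix d assume d: "d \<in> B"
    then obtain e where e: "d = p * e" by (auto simp: B_def)
    have "\<not> p dvd e"
    proof
      assume "p dvd e"
      then have "p ^ 2 dvd d" using e by (auto simp: power2_eq_square)
      then have "p dvd 1" using d squarefreeD[of d p] by (simp add: B_def)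
      then show False using p by auto
    qed
    moreover have "squarefree e" "e dvd n"
      using d e squarefree_mono[of e d] dvd_trans[of e d n] by (auto simp: B_def)
    ultimately show "d \<in> (*) p ` A" using e by (auto simp: A_def)
  next
    fix d assume "d \<in> (*) p ` A"
    then obtain e where e: "d = p * e" "e dvd n" "squarefree e" "\<not> p dvd e"
      by (auto simp: A_def)
    have "coprime p e" using p e by (simp add: prime_imp_coprime)
    then show "d \<in> B"
      using e p squarefree_mult_coprime[of p e] squarefree_prime[OF p(1)] divides_mult[of p n e]
      by (auto simp: B_def)
  qed
  have "(\<Sum>d | d dvd n. moebius d) = (\<Sum>d\<in>A \<union> B. moebius d)"
    by (rule sum.mono_neutral_right) (use fin in \<open>auto simp: A_def B_def moebius_def\<close>)
  also have "\<dots> = (\<Sum>d\<in>A. moebius d) + (\<Sum>d\<in>B. moebius d)"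
    using finAB by (intro sum.union_disjoint) (auto simp: A_def B_def)
  also have "(\<Sum>d\<in>B. moebius d) = (\<Sum>d\<in>A. moebius (p * d))"
    unfolding B using \<open>p \<noteq> 0\<close> by (subst sum.reindex) (auto simp: inj_on_def)
  also have "\<dots> = (\<Sum>d\<in>A. - moebius d)"
    using p by (intro sum.cong) (auto simp: A_def intro: moebius_mult_prime)
  finally show ?thesis using False by (simp add: sum_negf)
qed

text \<open>Exchanging the two divisor sums gives \<open>g e\<close> the coefficient
  \<open>\<Sum>k | k dvd n div e. moebius k\<close>, which vanishes unless
  \<open>e = n\<close>.\<close>

lemma moebius_inversion:
  fixes f g :: "nat \<Rightarrow> real"
  assumes n: "n \<ge> 1" and f: "\<And>m. m \<ge> 1 \<Longrightarrow> f m = (\<Sum>d | d dvd m. g d)"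
  shows "g n = (\<Sum>d | d dvd n. real_of_int (moebius (n div d)) * f d)"
proof -
  have fin: "finite {d. d dvd n}" using n by simp
  have inner: "(\<Sum>d | d dvd n \<and> e dvd d. moebius (n div d)) = (if e = n then 1 else 0)"
    if e: "e dvd n" for e
  proof -
    have pos: "n div e \<ge> 1" "e \<noteq> 0" using e n by (auto elim!: dvdE)
    have "(\<Sum>d | d dvd n \<and> e dvd d. moebius (n div d)) = (\<Sum>k | k dvd n div e. moebius k)"
    proof (rule sum.reindex_bij_witness[of _ "\<lambda>k. n div k" "\<lambda>d. n div d"])
      fix k assume k: "k \<in> {k. k dvd n div e}"
      then obtain c where c: "n div e = k * c" by auto
      then have ne: "n = e * (k * c)" using e by (metis dvd_mult_div_cancel)
      then have "k \<noteq> 0" using n by auto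
      then have nk: "n div k = e * c" using ne by (simp add: mult.left_commute)
      then show "n div k \<in> {d. d dvd n \<and> e dvd d}" using ne by (auto simp: mult.left_commute)
      show "n div (n div k) = k" using nk ne n by (simp add: mult.left_commute)
    next
      fix d assume d: "d \<in> {d. d dvd n \<and> e dvd d}"
      then obtain c c' where c: "d = e * c" "n = d * c'" by (metis dvdE mem_Collect_eq)
      then show "n div (n div d) = d" using n by auto
      show "n div d \<in> {k. k dvd n div e}" using c n pos by (auto simp: mult.assoc)
    qed simp
    also have "\<dots> = (if n div e = 1 then 1 else 0)" by (rule sum_moebius_divisors[OF pos(1)])
    also have "(n div e = 1) = (e = n)" using e n
      by (metis One_nat_def div_self dvd_mult_div_cancel mult.right_neutral not_one_le_zero)
    finally show ?thesis .
  qed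
  have "(\<Sum>d | d dvd n. real_of_int (moebius (n div d)) * f d)
      = (\<Sum>d | d dvd n. \<Sum>e | e dvd n \<and> e dvd d. real_of_int (moebius (n div d)) * g e)"
  proof (rule sum.cong[OF refl])
    fix d assume d: "d \<in> {d. d dvd n}"
    then have "d \<ge> 1" using n by (auto simp: Suc_le_eq dest: dvd_pos_nat)
    moreover have "{e. e dvd n \<and> e dvd d} = {e. e dvd d}" using d dvd_trans by blast
    ultimately show "real_of_int (moebius (n div d)) * f d
        = (\<Sum>e | e dvd n \<and> e dvd d. real_of_int (moebius (n div d)) * g e)"
      by (simp add: f sum_distrib_left)
  qed
  also have "\<dots> = (\<Sum>e | e dvd n. \<Sum>d | d dvd n \<and> e dvd d. real_of_int (moebius (n div d)) * g e)"
    using sum.swap_restrict[OF fin fin, of _ "\<lambda>d e. e dvd d"] by simp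
  also have "\<dots> = (\<Sum>e | e dvd n. real_of_int (\<Sum>d | d dvd n \<and> e dvd d. moebius (n div d)) * g e)"
    by (simp add: sum_distrib_right)
  also have "\<dots> = (\<Sum>e | e dvd n. (if e = n then g e else 0))"
    by (intro sum.cong refl) (simp add: inner)
  also have "\<dots> = g n" using fin by (simp add: sum.delta)
  finally show ?thesis by simp
qed

section \<open>Siteswaps as periodic sequences of landing times\<close>

text \<open>\<open>\<sigma> t\<close> holds, for each ball in the air just before the throw at time \<open>t\<close>, the time left until
  it lands; balls with entry 0 are the ones thrown at time \<open>t\<close>.\<close>
definition landing_seqs :: "nat \<Rightarrow> nat \<Rightarrow> (nat \<Rightarrow> nat multiset) set" where
  "landing_seqs b n = {\<sigma>. (\<forall>t. \<sigma> (t + n) = \<sigma> t) \<and> (\<forall>t. size (\<sigma> t) = b)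
     \<and> (\<forall>t h. count (\<sigma> t) (Suc h) \<le> count (\<sigma> (Suc t)) h)}"

text \<open>\<open>image_mset Suc\<close> measures the next state from time \<open>t\<close>; the
  difference cancels the balls already in the air. The entries 0 of \<open>\<sigma> t\<close> have
  no counterpart there, so subtracting them has no effect.\<close>

definition throws :: "(nat \<Rightarrow> nat multiset) \<Rightarrow> nat \<Rightarrow> nat multiset" where
  "throws \<sigma> t = image_mset Suc (\<sigma> (Suc t)) - \<sigma> t"

definition siteswap_of :: "nat \<Rightarrow> (nat \<Rightarrow> nat multiset) \<Rightarrow> nat multiset list" where
  "siteswap_of n \<sigma> = map (throws \<sigma>) [0..<n]"

section \<open>Sums over one period\<close>

lemma periodic_mult:
  fixes f :: "nat \<Rightarrow> 'a"
  assumes "\<And>t. f (t + n) = f t"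
  shows "f (t + k * n) = f t"
proof (induction k)
  case (Suc k)
  then show ?case using assms[of "t + k * n"] by (simp add: algebra_simps)
qed simp

lemma periodic_mod:
  fixes f :: "nat \<Rightarrow> 'a"
  assumes "\<And>t. f (t + n) = f t"
  shows "f (t mod n) = f t"
  using periodic_mult[of f n "t mod n" "t div n", OF assms] by simp

lemma sum_periodic_shift:
  fixes f :: "nat \<Rightarrow> nat"
  assumes "\<And>t. f (t + n) = f t"
  shows "(\<Sum>s<n. f (t + s)) = (\<Sum>s<n. f s)"
proof (induction t)
  case (Suc t)
  have "(\<Sum>s<n. f (Suc t + s)) + f t = (\<Sum>s<Suc n. f (t + s))"
    by (subst sum.lessThan_Suc_shift) simp
  also have "\<dots> = (\<Sum>s<n. f (t + s)) + f t" by (simp add: assms)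
  finally show ?case using Suc by simp
qed simp

text \<open>Hermite's identity for the floor function: passing from \<open>x\<close> to
  \<open>Suc x\<close> drops the term \<open>x div n\<close> and appends
  \<open>(n + x) div n\<close>, which is larger by one.\<close>

lemma hermite_identity:
  fixes n x :: nat
  assumes "n \<ge> 1"
  shows "(\<Sum>s<n. (s + x) div n) = x"
proof (induction x)
  case (Suc x)
  have "(\<Sum>s<n. (s + Suc x) div n) + x div n = (\<Sum>s<Suc n. (s + x) div n)"
    by (subst sum.lessThan_Suc_shift) simp
  also have "\<dots> = x + Suc (x div n)" using assms Suc by simp
  finally show ?case by simp
qed (use assms in simp)

lemma count_image_mset_Suc [simp]:
  "count (image_mset Suc X) (Suc h) = count X h" "count (image_mset Suc X) 0 = 0"
  by (induction X) auto

text \<open>With \<open>y\<close> the landing time of a ball relative to now, these are the landing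
  times of its copies thrown \<open>j\<close> periods earlier, as far as those have not landed
  before now. The copy \<open>j = 0\<close> is excluded because it is not yet thrown.\<close>

definition residues_below :: "nat \<Rightarrow> nat \<Rightarrow> nat multiset" where
  "residues_below n y = image_mset (\<lambda>j. y - n * j) (mset_set {1..y div n})"

lemma size_residues_below [simp]: "size (residues_below n y) = y div n"
  by (simp add: residues_below_def)

lemma image_Suc_residues_below:
  assumes "n \<ge> 1"
  shows "image_mset Suc (residues_below n y) + (if n dvd Suc y then {#0#} else {#})
    = residues_below n (Suc y)"
proof -
  have *: "image_mset Suc (residues_below n y)
      = image_mset (\<lambda>j. Suc y - n * j) (mset_set {1..y div n})"
  proof -
    have "n * j \<le> y" if "j \<le> y div n" for j
      using that assms by (metis div_times_less_eq_dividend le_trans mult.commute mult_le_mono2)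
    then show ?thesis unfolding residues_below_def
      by (auto simp: multiset.map_comp intro!: image_mset_cong simp: Suc_diff_le)
  qed
  show ?thesis
  proof (cases "n dvd Suc y")
    case True
    then have d: "Suc y div n = Suc (y div n)" using assms
      by (simp add: div_Suc dvd_eq_mod_eq_0)
    have "{1..Suc (y div n)} = insert (Suc (y div n)) {1..y div n}" by auto
    moreover have "Suc y - n * Suc (y div n) = 0" using True d
      by (metis diff_self_eq_0 dvd_mult_div_cancel)
    ultimately show ?thesis using True d * by (simp add: residues_below_def)
  next
    case False
    then have "Suc y div n = y div n" by (simp add: div_Suc dvd_eq_mod_eq_0)
    then show ?thesis using False * by (simp add: residues_below_def)
  qed
qed

lemma residues_below_add:
  assumes "n \<ge> 1"
  shows "residues_below n (n + y) = add_mset y (residues_below n y)"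
proof -
  have "{1..(n + y) div n} = insert 1 (Suc ` {1..y div n})" using assms
    by (auto simp: image_Suc_atLeastAtMost)
  moreover have "mset_set (Suc ` {1..y div n}) = image_mset Suc (mset_set {1..y div n})"
    by (rule image_mset_mset_set[symmetric]) simp
  ultimately show ?thesis
    by (simp add: residues_below_def multiset.map_comp comp_def)
qed

text \<open>A ball thrown at time \<open>t + s - j * n\<close> (\<open>j \<ge> 1\<close>) to height \<open>x\<close> lands at
  time \<open>t + (s + x - j * n)\<close>.\<close>
definition airborne :: "nat \<Rightarrow> (nat \<Rightarrow> nat multiset) \<Rightarrow> nat \<Rightarrow> nat multiset" where
  "airborne n m t = (\<Sum>s<n. \<Sum>x\<in>#m (t + s). residues_below n (s + x))"

definition arrivals :: "nat \<Rightarrow> (nat \<Rightarrow> nat multiset) \<Rightarrow> nat \<Rightarrow> nat" where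
  "arrivals n m t = (\<Sum>s<n. size (filter_mset (\<lambda>x. n dvd s + x) (m (t + s))))"

lemma image_mset_sum:
  "finite A \<Longrightarrow> image_mset f (\<Sum>a\<in>A. g a) = (\<Sum>a\<in>A. image_mset f (g a))"
  by (induction A rule: finite_induct) auto

lemma image_Suc_sum_residues_below:
  assumes "n \<ge> 1"
  shows "image_mset Suc (\<Sum>x\<in>#X. residues_below n (s + x))
      + replicate_mset (size (filter_mset (\<lambda>x. n dvd Suc s + x) X)) 0
    = (\<Sum>x\<in>#X. residues_below n (Suc s + x))"
proof (induction X)
  case (add x X)
  have "image_mset Suc (\<Sum>x\<in>#add_mset x X. residues_below n (s + x))
      + replicate_mset (size (filter_mset (\<lambda>x. n dvd Suc s + x) (add_mset x X))) 0
    = (image_mset Suc (residues_below n (s + x)) + (if n dvd Suc (s + x) then {#0#} else {#}))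
      + (image_mset Suc (\<Sum>x\<in>#X. residues_below n (s + x))
      + replicate_mset (size (filter_mset (\<lambda>x. n dvd Suc s + x) X)) 0)"
    by simp
  then show ?case unfolding image_Suc_residues_below[OF assms] add.IH by simp
qed simp

lemma replicate_mset_add: "replicate_mset (k + l) x = replicate_mset k x + replicate_mset l x"
  by (induction k) auto

lemma replicate_mset_sum:
  "finite A \<Longrightarrow> replicate_mset (\<Sum>a\<in>A. g a) x = (\<Sum>a\<in>A. replicate_mset (g a) x)"
  by (induction A rule: finite_induct) (auto simp: replicate_mset_add)

text \<open>A conservation law: the balls in the air together with those just thrown are the next
  state, one time unit further off, together with the balls landing now. Moving to
  \<open>Suc t\<close> shifts the summation index by one, and the term \<open>s = n\<close> exceeds
  the term \<open>s = 0\<close> exactly by the new throws \<open>m t\<close>.\<close>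

lemma airborne_Suc:
  assumes n: "n \<ge> 1" and per: "\<And>t. m (t + n) = m t"
  shows "image_mset Suc (airborne n m (Suc t)) + replicate_mset (arrivals n m t) 0
    = airborne n m t + m t"
proof -
  define R where "R s = (\<Sum>x\<in>#m (t + s). residues_below n (s + x))" for s
  define Z where "Z s = size (filter_mset (\<lambda>x. n dvd s + x) (m (t + s)))" for s
  have Zn: "Z n = Z 0" by (simp add: Z_def per)
  have Rn: "R n = R 0 + m t"
  proof -
    have "(\<Sum>x\<in>#X. residues_below n (n + x)) = (\<Sum>x\<in>#X. residues_below n x) + X" for X
      by (induction X) (auto simp: residues_below_add[OF n])
    then show ?thesis by (simp add: R_def per)
  qed
  have "arrivals n m t + Z n = (\<Sum>s<n. Z (Suc s)) + Z 0"
    using sum.lessThan_Suc_shift[of Z n] by (simp add: arrivals_def Z_def)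
  then have arr: "arrivals n m t = (\<Sum>s<n. Z (Suc s))" using Zn by simp
  have "image_mset Suc (airborne n m (Suc t)) + replicate_mset (arrivals n m t) 0
      = (\<Sum>s<n. image_mset Suc (\<Sum>x\<in>#m (t + Suc s). residues_below n (s + x))
          + replicate_mset (Z (Suc s)) 0)"
    unfolding arr airborne_def by (simp add: image_mset_sum replicate_mset_sum sum.distrib)
  also have "\<dots> = (\<Sum>s<n. R (Suc s))"
    unfolding Z_def R_def by (intro sum.cong refl image_Suc_sum_residues_below[OF n])
  also have "R 0 + \<dots> = (\<Sum>s<n. R s) + R n"
    using sum.lessThan_Suc_shift[of R n] by simp
  then have "(\<Sum>s<n. R (Suc s)) = airborne n m t + m t"
    using Rn by (simp add: airborne_def R_def)
  finally show ?thesis .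
qed

lemma airborne_periodic:
  assumes "\<And>t. m (t + n) = m t"
  shows "airborne n m (t + n) = airborne n m t"
proof -
  have "m (t + n + s) = m (t + s)" for s
    using assms[of "t + s"] by (simp add: add.commute add.left_commute)
  then show ?thesis by (simp add: airborne_def)
qed

text \<open>Each throw \<open>x\<close> is counted \<open>(s + x) div n\<close> times for every
  offset \<open>s < n\<close> between observation and throw; by Hermite's identity these counts add
  up to \<open>x\<close>.\<close>

lemma sum_size_airborne:
  assumes n: "n \<ge> 1" and per: "\<And>t. m (t + n) = m t"
  shows "(\<Sum>t<n. size (airborne n m t)) = (\<Sum>t<n. sum_mset (m t))"
proof -
  define g where "g s t = (\<Sum>x\<in>#m t. (s + x) div n)" for s t
  have sz: "size (airborne n m t) = (\<Sum>s<n. g s (t + s))" for t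
  proof -
    have "size (\<Sum>x\<in>#X. residues_below n (s + x)) = (\<Sum>x\<in>#X. (s + x) div n)" for X s
      by (induction X) auto
    moreover have "size (\<Sum>a\<in>A. h a) = (\<Sum>a\<in>A. size (h a))" if "finite A"
      for A :: "nat set" and h :: "nat \<Rightarrow> nat multiset"
      using that by (induction A rule: finite_induct) auto
    ultimately show ?thesis by (simp add: airborne_def g_def)
  qed
  have "(\<Sum>t<n. size (airborne n m t)) = (\<Sum>s<n. \<Sum>t<n. g s (t + s))"
    unfolding sz by (rule sum.swap)
  also have "\<dots> = (\<Sum>s<n. \<Sum>t<n. g s t)"
  proof (rule sum.cong[OF refl])
    fix s
    show "(\<Sum>t<n. g s (t + s)) = (\<Sum>t<n. g s t)"
      using sum_periodic_shift[of "g s" n s] by (simp add: g_def per add.commute)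
  qed
  also have "\<dots> = (\<Sum>t<n. \<Sum>s<n. g s t)" by (rule sum.swap)
  also have "\<dots> = (\<Sum>t<n. sum_mset (m t))"
  proof (rule sum.cong[OF refl])
    fix t
    have "(\<Sum>s<n. \<Sum>x\<in>#X. (s + x) div n) = sum_mset X" for X
      by (induction X) (auto simp: sum.distrib hermite_identity[OF n])
    then show "(\<Sum>s<n. g s t) = sum_mset (m t)" by (simp add: g_def)
  qed
  finally show ?thesis .
qed

text \<open>The difference of two solutions is constant along the diagonals \<open>t + h = const\<close> and
  periodic, while each state has finite support.\<close>
lemma landing_recurrence_unique:
  fixes \<sigma> \<tau> m :: "nat \<Rightarrow> nat multiset"
  assumes n: "n \<ge> 1" and per: "\<And>t. \<sigma> (t + n) = \<sigma> t" "\<And>t. \<tau> (t + n) = \<tau> t"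
    and rec: "\<And>t h. count (\<sigma> (Suc t)) h = count (\<sigma> t) (Suc h) + count (m t) (Suc h)"
      "\<And>t h. count (\<tau> (Suc t)) h = count (\<tau> t) (Suc h) + count (m t) (Suc h)"
  shows "\<sigma> t = \<tau> t"
proof (rule multiset_eqI)
  fix h
  have diag: "count (\<sigma> (t + k)) h + count (\<tau> t) (h + k) = count (\<tau> (t + k)) h + count (\<sigma> t) (h + k)"
    for h k
  proof (induction k arbitrary: h)
    case (Suc k)
    show ?case using Suc[of "Suc h"] by (simp add: rec)
  qed simp
  \<comment> \<open>Every entry of a multiset is at most its sum, so \<open>K\<close> exceeds all
    entries of both states, and going \<open>K\<close> full periods along a diagonal leaves both
    supports.\<close>
  define K where "K = Suc (sum_mset (\<sigma> t) + sum_mset (\<tau> t))"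
  have big: "y \<notin># X" if "sum_mset X < y" for y :: nat and X
    using that sum_mset.remove[of y X] by force
  have "K \<le> h + K * n" using n by (simp add: trans_le_add2)
  then have "sum_mset (\<sigma> t) < h + K * n" "sum_mset (\<tau> t) < h + K * n"
    by (simp_all add: K_def)
  then have "count (\<sigma> t) (h + K * n) = 0" "count (\<tau> t) (h + K * n) = 0"
    using big by (auto simp: count_eq_zero_iff)
  then show "count (\<sigma> t) h = count (\<tau> t) h"
    using diag[of "K * n" h] periodic_mult[of \<sigma>, OF per(1)] periodic_mult[of \<tau>, OF per(2)] by simp
qed

section \<open>The siteswap condition as conservation of balls\<close>

lemma arrivals_eq:
  assumes n: "n \<ge> 1" and per: "\<And>t. m (t + n) = m t"
  shows "arrivals n m t = (\<Sum>s<n. size (filter_mset (\<lambda>h. (s + h) mod n = t mod n) (m s)))"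
proof -
  define g where "g r = size (filter_mset (\<lambda>h. (r + h) mod n = t mod n) (m r))" for r
  have gper: "g (r + n) = g r" for r
  proof -
    have "(r + n + h) mod n = (r + h) mod n" for h
      by (metis add.assoc add.commute mod_add_self2)
    then show ?thesis by (simp add: g_def per)
  qed
  have "n dvd s + x \<longleftrightarrow> (t + s + x) mod n = t mod n" for s x
    using mod_eq_dvd_iff_nat[of t "t + s + x" n] by (auto simp: add.assoc)
  then have "arrivals n m t = (\<Sum>s<n. g (t + s))" by (simp add: arrivals_def g_def)
  also have "\<dots> = (\<Sum>s<n. g s)" by (rule sum_periodic_shift[of g, OF gper])
  finally show ?thesis by (simp add: g_def)
qed

lemma is_mss_iff:
  assumes n: "n \<ge> 1" and len: "length M = n"
  defines "m \<equiv> \<lambda>t. M ! (t mod n)"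
  shows "is_mss n M \<longleftrightarrow> (\<forall>t. 0 \<notin># m t) \<and> (\<forall>t. size (m t) = arrivals n m t)"
proof -
  have mod_all: "(\<forall>t<n. P t) \<longleftrightarrow> (\<forall>t. P (t mod n))" for P
    using n by (metis less_eq_Suc_le mod_less mod_less_divisor One_nat_def)
  have per: "m (t + n) = m t" for t by (simp add: m_def)
  have arr: "arrivals n m t
      = (\<Sum>s<n. size (filter_mset (\<lambda>h. (s + h) mod n = t mod n) (M ! s)))" for t
    unfolding arrivals_eq[of n m, OF n per] by (intro sum.cong refl) (simp add: m_def)
  have pos: "(\<forall>h\<in>#X. 0 < h) \<longleftrightarrow> 0 \<notin># X" for X :: "nat multiset"
    by (metis gr0I less_irrefl)
  show ?thesis unfolding is_mss_def mod_all pos arr using len by (simp add: m_def)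
qed

text \<open>As many balls are thrown as arrive, so the number in the air is constant and equals its
  average over a period.\<close>

lemma sum_size_const_airborne:
  assumes n: "n \<ge> 1" and per: "\<And>t. m (t + n) = m t" and arr: "\<And>t. size (m t) = arrivals n m t"
  shows "n * size (airborne n m t) = (\<Sum>t<n. sum_mset (m t))"
proof -
  have "size (airborne n m (Suc t)) = size (airborne n m t)" for t
    using arg_cong[OF airborne_Suc[of n m, OF n per, of t], of size] arr[of t] by simp
  then have const: "size (airborne n m t) = size (airborne n m 0)" for t
    by (induction t) auto
  have "(\<Sum>t<n. sum_mset (m t)) = (\<Sum>t<n. size (airborne n m t))"
    using sum_size_airborne[of n m, OF n per] by simp
  also have "\<dots> = (\<Sum>t<n. size (airborne n m 0))" by (intro sum.cong refl const)
  finally show ?thesis using const[of t] by simp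
qed

lemma count_airborne_Suc:
  assumes n: "n \<ge> 1" and per: "\<And>t. m (t + n) = m t"
  shows "count (airborne n m (Suc t)) h = count (airborne n m t) (Suc h) + count (m t) (Suc h)"
  using arg_cong[OF airborne_Suc[of n m, OF n per, of t], of "\<lambda>X. count X (Suc h)"] by simp

lemma landing_seqsD:
  assumes "\<sigma> \<in> landing_seqs b n"
  shows "\<sigma> (t + n) = \<sigma> t" "size (\<sigma> t) = b" "count (\<sigma> t) (Suc h) \<le> count (\<sigma> (Suc t)) h"
  using assms by (auto simp: landing_seqs_def)

lemma throws_periodic:
  assumes "\<sigma> \<in> landing_seqs b n"
  shows "throws \<sigma> (t + n) = throws \<sigma> t"
  using landing_seqsD(1)[OF assms, of t] landing_seqsD(1)[OF assms, of "Suc t"]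
  by (simp add: throws_def)

lemma nth_siteswap_of:
  assumes "\<sigma> \<in> landing_seqs b n" "n \<ge> 1"
  shows "siteswap_of n \<sigma> ! (t mod n) = throws \<sigma> t"
  using periodic_mod[of "throws \<sigma>" n t, OF throws_periodic[OF assms(1)]] assms(2)
  by (simp add: siteswap_of_def)

text \<open>The inverse is \<open>airborne\<close> on the periodic extension. It recovers
  \<open>\<sigma>\<close> from its throws since both satisfy the same recurrence, and the siteswap
  condition for these throws is then the size part of the conservation law.\<close>

lemma bij_betw_siteswap_of:
  assumes n: "n \<ge> 1"
  shows "bij_betw (siteswap_of n) (landing_seqs b n) {M. is_mss n M \<and> mss_balls_eq b n M}"
proof (rule bij_betw_byWitness[where f' = "\<lambda>M. airborne n (\<lambda>t. M ! (t mod n))"])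
  have inv: "airborne n (throws \<sigma>) = \<sigma>" if \<sigma>: "\<sigma> \<in> landing_seqs b n" for \<sigma>
  proof
    fix t
    note D = landing_seqsD[OF \<sigma>] and per = throws_periodic[OF \<sigma>]
    show "airborne n (throws \<sigma>) t = \<sigma> t"
    proof (rule landing_recurrence_unique[OF n, where m = "throws \<sigma>"])
      show "airborne n (throws \<sigma>) (t + n) = airborne n (throws \<sigma>) t" for t
        by (rule airborne_periodic[of "throws \<sigma>", OF per])
      show "count (airborne n (throws \<sigma>) (Suc t)) h
          = count (airborne n (throws \<sigma>) t) (Suc h) + count (throws \<sigma> t) (Suc h)" for t h
        by (rule count_airborne_Suc[of n "throws \<sigma>", OF n per])
      show "count (\<sigma> (Suc t)) h = count (\<sigma> t) (Suc h) + count (throws \<sigma> t) (Suc h)" for t h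
        using D(3)[of t h] by (simp add: throws_def)
    qed (rule D(1))
  qed
  then show "\<forall>\<sigma>\<in>landing_seqs b n. airborne n (\<lambda>t. siteswap_of n \<sigma> ! (t mod n)) = \<sigma>"
    using n by (simp add: nth_siteswap_of)
  show "siteswap_of n ` landing_seqs b n \<subseteq> {M. is_mss n M \<and> mss_balls_eq b n M}"
  proof clarify
    fix \<sigma> assume \<sigma>: "\<sigma> \<in> landing_seqs b n"
    note D = landing_seqsD[OF \<sigma>] and per = throws_periodic[OF \<sigma>]
    have len: "length (siteswap_of n \<sigma>) = n" by (simp add: siteswap_of_def)
    have arr: "size (throws \<sigma> t) = arrivals n (throws \<sigma>) t" for t
      using arg_cong[OF airborne_Suc[of n "throws \<sigma>", OF n per, of t], of size] D(2) inv[OF \<sigma>] by simp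
    have "0 \<notin># throws \<sigma> t" for t by (simp add: throws_def count_eq_zero_iff[symmetric])
    then have "is_mss n (siteswap_of n \<sigma>)"
      using arr is_mss_iff[OF n len] by (simp add: nth_siteswap_of[OF \<sigma> n])
    moreover have "mss_balls_eq b n (siteswap_of n \<sigma>)"
      using sum_size_const_airborne[of n "throws \<sigma>", OF n per arr, of 0] D(2) inv[OF \<sigma>]
      by (simp add: mss_balls_eq_def siteswap_of_def mult.commute)
    ultimately show "is_mss n (siteswap_of n \<sigma>) \<and> mss_balls_eq b n (siteswap_of n \<sigma>)" ..
  qed
  have witness: "siteswap_of n (airborne n (\<lambda>t. M ! (t mod n))) = M
      \<and> airborne n (\<lambda>t. M ! (t mod n)) \<in> landing_seqs b n"
    if M: "is_mss n M" "mss_balls_eq b n M" for M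
  proof
    define m where "m = (\<lambda>t. M ! (t mod n))"
    have len: "length M = n" using M by (simp add: is_mss_def)
    have per: "m (t + n) = m t" for t by (simp add: m_def)
    have zero: "0 \<notin># m t" and arr: "size (m t) = arrivals n m t" for t
      using M(1) is_mss_iff[OF n len] by (simp_all add: m_def)
    note rec = count_airborne_Suc[of n m, OF n per]
    have "throws (airborne n m) t = m t" for t
    proof (rule multiset_eqI)
      fix h show "count (throws (airborne n m) t) h = count (m t) h"
        using zero[of t] by (cases h) (auto simp: throws_def rec count_eq_zero_iff)
    qed
    then show "siteswap_of n (airborne n m) = M"
      using len by (auto simp: siteswap_of_def m_def intro!: nth_equalityI)
    have "n * size (airborne n m t) = b * n" for t
      using sum_size_const_airborne[of n m, OF n per arr, of t] M(2) by (simp add: mss_balls_eq_def m_def)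
    then have "size (airborne n m t) = b" for t using n by (metis mult.commute mult_right_cancel not_one_le_zero)
    then show "airborne n m \<in> landing_seqs b n"
      using airborne_periodic[of m, OF per] rec by (simp add: landing_seqs_def)
  qed
  show "\<forall>M\<in>{M. is_mss n M \<and> mss_balls_eq b n M}.
      siteswap_of n (airborne n (\<lambda>t. M ! (t mod n))) = M"
    using witness by blast
  show "(\<lambda>M. airborne n (\<lambda>t. M ! (t mod n))) ` {M. is_mss n M \<and> mss_balls_eq b n M}
      \<subseteq> landing_seqs b n"
    using witness by blast
qed

lemma siteswap_of_shift:
  assumes \<sigma>: "\<sigma> \<in> landing_seqs b n" and n: "n \<ge> 1"
  shows "siteswap_of n (\<lambda>t. \<sigma> (t + k)) = rotate k (siteswap_of n \<sigma>)"
proof (rule nth_equalityI)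
  fix t assume "t < length (siteswap_of n (\<lambda>t. \<sigma> (t + k)))"
  then have "t < n" by (simp add: siteswap_of_def)
  then have "rotate k (siteswap_of n \<sigma>) ! t = siteswap_of n \<sigma> ! ((k + t) mod n)"
    by (simp add: siteswap_of_def nth_rotate)
  also have "\<dots> = throws \<sigma> (k + t)" by (rule nth_siteswap_of[OF \<sigma> n])
  finally show "siteswap_of n (\<lambda>t. \<sigma> (t + k)) ! t = rotate k (siteswap_of n \<sigma>) ! t"
    using \<open>t < n\<close> by (simp add: siteswap_of_def throws_def add.commute)
qed (simp add: siteswap_of_def)

lemma landing_seqs_shift:
  assumes "\<sigma> \<in> landing_seqs b n"
  shows "(\<lambda>t. \<sigma> (t + k)) \<in> landing_seqs b n"
proof -
  have "\<sigma> (t + n + k) = \<sigma> (t + k)" for t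
    using landing_seqsD(1)[OF assms, of "t + k"] by (simp add: add.assoc add.commute[of n k])
  then show ?thesis using assms by (auto simp: landing_seqs_def)
qed

section \<open>Counting rotation orbits\<close>

definition primitive_seqs :: "nat \<Rightarrow> nat \<Rightarrow> (nat \<Rightarrow> nat multiset) set" where
  "primitive_seqs b n = {\<sigma> \<in> landing_seqs b n. \<forall>d. 1 \<le> d \<and> d < n \<longrightarrow> (\<lambda>t. \<sigma> (t + d)) \<noteq> \<sigma>}"

lemma landing_seqs_dvd:
  assumes "d dvd n"
  shows "landing_seqs b d \<subseteq> landing_seqs b n"
proof
  fix \<sigma> assume \<sigma>: "\<sigma> \<in> landing_seqs b d"
  obtain k where k: "n = k * d" using assms by (metis dvdE mult.commute)
  have "\<sigma> (t + n) = \<sigma> t" for t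
    unfolding k by (rule periodic_mult[of \<sigma>, OF landing_seqsD(1)[OF \<sigma>]])
  then show "\<sigma> \<in> landing_seqs b n" using \<sigma> by (simp add: landing_seqs_def)
qed

text \<open>If \<open>d\<close> is the least period, then \<open>n mod d\<close> also leaves the
  sequence invariant, so it must be 0.\<close>

lemma landing_seqs_eq_UN_primitive_seqs:
  assumes n: "n \<ge> 1"
  shows "landing_seqs b n = (\<Union>d\<in>{d. d dvd n}. primitive_seqs b d)"
proof (intro equalityI subsetI)
  fix \<sigma> assume \<sigma>: "\<sigma> \<in> landing_seqs b n"
  define P where "P d \<longleftrightarrow> 1 \<le> d \<and> (\<forall>t. \<sigma> (t + d) = \<sigma> t)" for d
  define d where "d = (LEAST d. P d)"
  have "P n" using n landing_seqsD(1)[OF \<sigma>] by (simp add: P_def)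
  then have Pd: "P d" unfolding d_def by (rule LeastI)
  have least: "\<not> P e" if "e < d" for e using that not_less_Least by (auto simp: d_def)
  have "\<sigma> (t + n mod d) = \<sigma> t" for t
  proof -
    have "\<sigma> (t + d) = \<sigma> t" for t using Pd by (simp add: P_def)
    then have "\<sigma> (t + n mod d) = \<sigma> (t + n mod d + (n div d) * d)"
      by (rule periodic_mult[of \<sigma>, symmetric])
    also have "\<dots> = \<sigma> (t + n)" by (simp add: add.assoc)
    finally show ?thesis using landing_seqsD(1)[OF \<sigma>] by simp
  qed
  then have "\<not> 1 \<le> n mod d" using least[of "n mod d"] Pd by (auto simp: P_def)
  then have dvd: "d dvd n" by (simp add: dvd_eq_mod_eq_0)
  have "\<sigma> \<in> primitive_seqs b d"
    using Pd least \<sigma> by (auto simp: primitive_seqs_def landing_seqs_def P_def fun_eq_iff)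
  then show "\<sigma> \<in> (\<Union>d\<in>{d. d dvd n}. primitive_seqs b d)" using dvd by blast
qed (use landing_seqs_dvd in \<open>auto simp: primitive_seqs_def\<close>)

lemma card_landing_seqs:
  assumes n: "n \<ge> 1" and fin: "finite (landing_seqs b n)"
  shows "card (landing_seqs b n) = (\<Sum>d | d dvd n. card (primitive_seqs b d))"
  unfolding landing_seqs_eq_UN_primitive_seqs[OF n]
proof (rule card_UN_disjoint)
  show "finite {d. d dvd n}" using n by simp
  show "\<forall>d\<in>{d. d dvd n}. finite (primitive_seqs b d)"
    using fin unfolding landing_seqs_eq_UN_primitive_seqs[OF n]
    by (auto intro: finite_subset[rotated])
  have disj: "primitive_seqs b d \<inter> primitive_seqs b e = {}" if "1 \<le> d" "d < e" for d e
  proof -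
    have "(\<lambda>t. \<sigma> (t + d)) = \<sigma>" if "\<sigma> \<in> primitive_seqs b d" for \<sigma>
      using that landing_seqsD(1)[of \<sigma> b d] by (auto simp: primitive_seqs_def)
    then show ?thesis using that by (auto simp: primitive_seqs_def)
  qed
  have "1 \<le> d" if "d dvd n" for d using that n by (auto intro: Nat.gr0I simp: Suc_le_eq)
  then show "\<forall>d\<in>{d. d dvd n}. \<forall>e\<in>{d. d dvd n}. d \<noteq> e \<longrightarrow>
      primitive_seqs b d \<inter> primitive_seqs b e = {}"
    using disj by (metis inf_commute linorder_neqE_nat mem_Collect_eq)
qed

section \<open>Rotations of lists and their orbits\<close>

lemma rotate_inverse: "rotate (k * (length xs - 1)) (rotate k xs) = xs"
proof (cases xs)
  case (Cons x ys)
  then have "k * (length xs - 1) + k = k * length xs" by simp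
  then show ?thesis by (simp add: rotate_rotate rotate_conv_mod[of "k * length xs"])
qed simp

lemma rotate_cancel: "rotate k xs = rotate k ys \<longleftrightarrow> xs = ys"
  by (metis rotate_inverse length_rotate)

lemma range_rotate_rotate: "range (\<lambda>k. rotate k (rotate i xs)) = range (\<lambda>k. rotate k xs)"
proof (intro equalityI subsetI)
  fix ys assume "ys \<in> range (\<lambda>k. rotate k xs)"
  then obtain k where "ys = rotate k xs" by auto
  then have "ys = rotate (k + i * (length xs - 1)) (rotate i xs)"
    using rotate_inverse[of i xs] by (simp flip: rotate_rotate)
  then show "ys \<in> range (\<lambda>k. rotate k (rotate i xs))" by blast
qed (auto simp: rotate_rotate)

lemma min_period_is_iff:
  assumes n: "n \<ge> 1" and len: "length M = n"
  shows "min_period_is n M \<longleftrightarrow> (\<forall>d. 1 \<le> d \<and> d < n \<longrightarrow> rotate d M \<noteq> M)"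
proof -
  have rot: "(\<forall>t<n. M ! ((t + d) mod n) = M ! t) \<longleftrightarrow> rotate d M = M" for d
    using len by (auto simp: list_eq_iff_nth_eq nth_rotate add.commute)
  define P where "P d \<longleftrightarrow> 1 \<le> d \<and> rotate d M = M" for d
  have Pn: "P n" using n len by (simp add: P_def)
  have "min_period_is n M \<longleftrightarrow> (LEAST d. P d) = n"
    by (simp add: min_period_is_def rot P_def)
  also have "\<dots> \<longleftrightarrow> (\<forall>d<n. \<not> P d)"
  proof
    assume "\<forall>d<n. \<not> P d"
    then show "(LEAST d. P d) = n" using Pn by (intro Least_equality) (auto simp: not_less[symmetric])
  qed (auto dest: not_less_Least)
  finally show ?thesis by (auto simp: P_def)
qed

text \<open>A time shift of states is a rotation of the siteswap, so primitive sequences correspond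
  to siteswaps of minimal period \<open>n\<close>. These are partitioned into rotation orbits, each
  with exactly \<open>n\<close> members because a coincidence of two rotations would give a smaller
  period.\<close>

lemma card_primitive_seqs:
  assumes n: "n \<ge> 1" and fin: "finite (landing_seqs b n)"
  shows "n * jp b n = card (primitive_seqs b n)"
proof -
  define PL where "PL = {M. is_mss n M \<and> mss_balls_eq b n M \<and> min_period_is n M}"
  note bij = bij_betw_siteswap_of[OF n, of b]
  have inj: "inj_on (siteswap_of n) (landing_seqs b n)" using bij by (rule bij_betw_imp_inj_on)
  have prim_iff: "min_period_is n (siteswap_of n \<sigma>) \<longleftrightarrow> \<sigma> \<in> primitive_seqs b n"
    if \<sigma>: "\<sigma> \<in> landing_seqs b n" for \<sigma>
  proof -
    have "rotate d (siteswap_of n \<sigma>) = siteswap_of n \<sigma> \<longleftrightarrow> (\<lambda>t. \<sigma> (t + d)) = \<sigma>" for d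
      unfolding siteswap_of_shift[OF \<sigma> n, symmetric]
      using inj_onD[OF inj _ landing_seqs_shift[OF \<sigma>] \<sigma>] by auto
    then show ?thesis using \<sigma>
      by (subst min_period_is_iff[OF n]) (auto simp: primitive_seqs_def siteswap_of_def)
  qed
  have PL: "PL = siteswap_of n ` primitive_seqs b n"
  proof -
    have "PL = {M \<in> siteswap_of n ` landing_seqs b n. min_period_is n M}"
      unfolding PL_def bij_betw_imp_surj_on[OF bij] by auto
    also have "\<dots> = siteswap_of n ` primitive_seqs b n"
      using prim_iff by (auto simp: primitive_seqs_def)
    finally show ?thesis .
  qed
  have sub: "primitive_seqs b n \<subseteq> landing_seqs b n" by (auto simp: primitive_seqs_def)
  have cardPL: "card PL = card (primitive_seqs b n)"
    unfolding PL by (rule card_image[OF inj_on_subset[OF inj sub]])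
  have finPL: "finite PL" unfolding PL using finite_subset[OF sub fin] by simp
  have len: "length M = n" if "M \<in> PL" for M using that by (simp add: PL_def is_mss_def)
  have aper: "rotate d M \<noteq> M" if "M \<in> PL" "1 \<le> d" "d < n" for M d
    using that min_period_is_iff[OF n len[OF that(1)]] by (simp add: PL_def)
  have closed: "rotate k M \<in> PL" if M: "M \<in> PL" for k M
  proof -
    \<comment> \<open>Invariance of the siteswap conditions under rotation is transported from the
      evident shift invariance of \<open>landing_seqs\<close>.\<close>
    obtain \<sigma> where \<sigma>: "\<sigma> \<in> landing_seqs b n" "M = siteswap_of n \<sigma>" using M PL sub by auto
    have "rotate k M \<in> siteswap_of n ` landing_seqs b n"
      unfolding \<sigma>(2) siteswap_of_shift[OF \<sigma>(1) n, symmetric]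
      by (intro imageI landing_seqs_shift[OF \<sigma>(1)])
    then have "is_mss n (rotate k M)" "mss_balls_eq b n (rotate k M)"
      unfolding bij_betw_imp_surj_on[OF bij] by auto
    moreover have "rotate d (rotate k M) = rotate k M \<longleftrightarrow> rotate d M = M" for d
      using rotate_cancel[of k "rotate d M" M] by (simp add: rotate_rotate add.commute)
    then have "min_period_is n (rotate k M)"
      using aper[OF M] len[OF M] by (subst min_period_is_iff[OF n]) auto
    ultimately show ?thesis by (simp add: PL_def)
  qed
  have pat: "patterns b n = (\<lambda>M. range (\<lambda>k. rotate k M)) ` PL"
    by (auto simp: patterns_def PL_def)
  have Un: "\<Union> (patterns b n) = PL"
  proof (intro equalityI subsetI)
    fix M assume "M \<in> PL"
    moreover have "M \<in> range (\<lambda>k. rotate k M)" by (rule image_eqI[of _ _ 0]) auto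
    ultimately show "M \<in> \<Union> (patterns b n)" unfolding pat by blast
  qed (auto simp: pat closed)
  have "n * card (patterns b n) = card (\<Union> (patterns b n))"
  proof (rule card_partition)
    show "finite (patterns b n)" "finite (\<Union> (patterns b n))"
      using finPL Un by (simp_all add: pat)
    show "card c = n" if c: "c \<in> patterns b n" for c
    proof -
      obtain M where M: "M \<in> PL" "c = range (\<lambda>k. rotate k M)" using c unfolding pat by blast
      have "c = (\<lambda>k. rotate k M) ` {..<n}"
      proof (intro equalityI subsetI)
        fix X assume "X \<in> c"
        then obtain k where "X = rotate k M" using M(2) by auto
        then have "X = rotate (k mod n) M" using rotate_conv_mod[of k M] len[OF M(1)] by metis
        then show "X \<in> (\<lambda>k. rotate k M) ` {..<n}" using n by auto
      qed (use M(2) in auto)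
      moreover have "inj_on (\<lambda>k. rotate k M) {..<n}"
      proof (rule linorder_inj_onI)
        fix i j :: nat assume ij: "i < j" "i \<in> {..<n}" "j \<in> {..<n}"
        have "rotate j M = rotate i (rotate (j - i) M)" using ij by (simp add: rotate_rotate)
        moreover have "rotate (j - i) M \<noteq> M" using ij by (intro aper[OF M(1)]) auto
        ultimately show "rotate i M \<noteq> rotate j M" by (metis rotate_cancel)
      qed auto
      ultimately show ?thesis by (simp add: card_image)
    qed
    show "c1 \<inter> c2 = {}" if c: "c1 \<in> patterns b n" "c2 \<in> patterns b n" "c1 \<noteq> c2" for c1 c2
    proof (rule ccontr)
      assume "c1 \<inter> c2 \<noteq> {}"
      then obtain X where X: "X \<in> c1" "X \<in> c2" by blast
      have "c = range (\<lambda>k. rotate k X)" if cX: "c \<in> patterns b n" "X \<in> c" for c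
      proof -
        obtain M where M: "c = range (\<lambda>k. rotate k M)" using cX(1) unfolding pat by blast
        then obtain i where "X = rotate i M" using cX(2) M by blast
        then show ?thesis using M range_rotate_rotate[of i M] by simp
      qed
      then show False using c X by blast
    qed
  qed
  then show ?thesis using Un cardPL by (simp add: jp_def)
qed

section \<open>Closed walks of cards\<close>

text \<open>Every step is stored with its source vertex and its label; the end vertex
  \<open>v\<close> is not stored. The recursion on the last step mirrors \<open>mat_pow\<close>, so
  the count follows by the same induction.\<close>

fun walks :: "'a set \<Rightarrow> ('a \<Rightarrow> 'a \<Rightarrow> 'c set) \<Rightarrow> nat \<Rightarrow> 'a \<Rightarrow> 'a \<Rightarrow> ('a \<times> 'c) list set" where
  "walks S C 0 u v = (if u = v then {[]} else {})"
| "walks S C (Suc n) u v =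
     (\<Union>w\<in>S. (\<lambda>(xs, c). xs @ [(w, c)]) ` (walks S C n u w \<times> C w v))"

lemma card_walks:
  assumes S: "finite S" and C: "\<And>u v. finite (C u v)"
  shows "finite (walks S C n u v) \<and> card (walks S C n u v) = mat_pow S (\<lambda>u v. card (C u v)) n u v"
proof (induction n arbitrary: v)
  case (Suc n)
  define A where "A w = (\<lambda>(xs, c). xs @ [(w, c)]) ` (walks S C n u w \<times> C w v)" for w
  have fin: "finite (A w)" for w using Suc C by (simp add: A_def)
  have cardA: "card (A w) = mat_pow S (\<lambda>u v. card (C u v)) n u w * card (C w v)" for w
  proof -
    have "card (A w) = card (walks S C n u w \<times> C w v)"
      unfolding A_def by (rule card_image) (auto simp: inj_on_def)
    then show ?thesis using Suc by (simp add: card_cartesian_product)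
  qed
  have "card (\<Union>w\<in>S. A w) = (\<Sum>w\<in>S. card (A w))"
    by (rule card_UN_disjoint) (use S fin in \<open>auto simp: A_def\<close>)
  then show ?case using S fin by (simp add: cardA) (simp add: A_def)
qed simp

lemma in_walks_iff:
  "xs \<in> walks S C n u v \<longleftrightarrow> length xs = n \<and> (map fst xs @ [v]) ! 0 = u
     \<and> (\<forall>i<n. fst (xs ! i) \<in> S \<and> snd (xs ! i) \<in> C (fst (xs ! i)) ((map fst xs @ [v]) ! Suc i))"
proof (induction n arbitrary: xs v)
  case (Suc n)
  show ?case
  proof (cases xs rule: rev_cases)
    case (snoc ys wc)
    obtain w c where wc: "wc = (w, c)" by force
    have "xs \<in> walks S C (Suc n) u v \<longleftrightarrow> w \<in> S \<and> c \<in> C w v \<and> ys \<in> walks S C n u w"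
      by (auto simp: snoc wc)
    also have "\<dots> \<longleftrightarrow> length xs = Suc n \<and> (map fst xs @ [v]) ! 0 = u
     \<and> (\<forall>i<Suc n. fst (xs ! i) \<in> S \<and> snd (xs ! i) \<in> C (fst (xs ! i)) ((map fst xs @ [v]) ! Suc i))"
    proof (cases "length ys = n")
      case True
      have "(\<forall>i<Suc n. Q i) \<longleftrightarrow> (\<forall>i<n. Q i) \<and> Q n" for Q by (auto simp: less_Suc_eq)
      moreover have "(map fst xs @ [v]) ! Suc i = (map fst ys @ [w]) ! Suc i" "xs ! i = ys ! i" if "i < n" for i
        using that True by (simp_all add: snoc wc nth_append)
      moreover have "xs ! n = (w, c)" "(map fst xs @ [v]) ! Suc n = v"
        using True by (simp_all add: snoc wc nth_append)
      moreover have "(map fst xs @ [v]) ! 0 = (map fst ys @ [w]) ! 0"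
        by (cases ys) (simp_all add: snoc wc)
      ultimately show ?thesis unfolding Suc.IH using True by (auto simp: snoc)
    qed (simp add: Suc.IH snoc)
    finally show ?thesis .
  qed auto
qed auto

definition closed_walks ::
  "'a set \<Rightarrow> ('a \<Rightarrow> 'a \<Rightarrow> 'c set) \<Rightarrow> nat \<Rightarrow> (nat \<Rightarrow> 'a \<times> 'c) set" where
  "closed_walks S C d = {x. (\<forall>t. x (t + d) = x t)
     \<and> (\<forall>t. fst (x t) \<in> S \<and> snd (x t) \<in> C (fst (x t)) (fst (x (Suc t))))}"

lemma bij_betw_closed_walks:
  assumes d: "d \<ge> 1"
  shows "bij_betw (\<lambda>x. map x [0..<d]) (closed_walks S C d) (\<Union>u\<in>S. walks S C d u u)"
proof (rule bij_betw_byWitness[where f' = "\<lambda>xs t. xs ! (t mod d)"])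
  have mod_lt: "t mod d < d" for t using d by simp
  show "\<forall>x\<in>closed_walks S C d. (\<lambda>t. map x [0..<d] ! (t mod d)) = x"
  proof
    fix x assume "x \<in> closed_walks S C d"
    then have "x (t + d) = x t" for t by (simp add: closed_walks_def)
    then have "x (t mod d) = x t" for t by (rule periodic_mod[of x])
    then show "(\<lambda>t. map x [0..<d] ! (t mod d)) = x" using mod_lt by (simp add: fun_eq_iff)
  qed
  show "\<forall>xs\<in>\<Union>u\<in>S. walks S C d u u. map (\<lambda>t. xs ! (t mod d)) [0..<d] = xs"
    by (auto simp: in_walks_iff intro!: nth_equalityI)
  show "(\<lambda>x. map x [0..<d]) ` closed_walks S C d \<subseteq> (\<Union>u\<in>S. walks S C d u u)"
  proof clarify
    fix x assume x: "x \<in> closed_walks S C d"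
    then have per: "x d = x 0" using allE[of "\<lambda>t. x (t + d) = x t" 0] by (auto simp: closed_walks_def)
    have "(map fst (map x [0..<d]) @ [fst (x 0)]) ! i = fst (x i)" if "i \<le> d" for i
      using that per by (cases "i = d") (auto simp: nth_append)
    then have "map x [0..<d] \<in> walks S C d (fst (x 0)) (fst (x 0))"
      using x by (auto simp: in_walks_iff closed_walks_def Suc_le_eq)
    then show "map x [0..<d] \<in> (\<Union>u\<in>S. walks S C d u u)" using x by (auto simp: closed_walks_def)
  qed
  show "(\<lambda>xs t. xs ! (t mod d)) ` (\<Union>u\<in>S. walks S C d u u) \<subseteq> closed_walks S C d"
  proof clarify
    fix u xs assume u: "u \<in> S" and "xs \<in> walks S C d u u"
    then have len: "length xs = d" and u0: "(map fst xs @ [u]) ! 0 = u"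
      and step: "\<And>i. i < d \<Longrightarrow> fst (xs ! i) \<in> S
        \<and> snd (xs ! i) \<in> C (fst (xs ! i)) ((map fst xs @ [u]) ! Suc i)"
      by (auto simp: in_walks_iff)
    \<comment> \<open>At the wrap-around the successor is the unstored end vertex, which for a
      closed walk is the first vertex of the list.\<close>
    have nxt: "(map fst xs @ [u]) ! Suc (t mod d) = fst (xs ! (Suc t mod d))" for t
    proof (cases "Suc (t mod d) = d")
      case True
      have "fst (xs ! 0) = u" using u0 len d by (simp add: nth_append)
      then show ?thesis using True len by (simp add: mod_Suc nth_append)
    next
      case False
      then have "Suc (t mod d) < d" using mod_lt[of t] by simp
      then show ?thesis using len by (simp add: mod_Suc nth_append)
    qed
    show "(\<lambda>t. xs ! (t mod d)) \<in> closed_walks S C d"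
      using step[OF mod_lt] by (simp add: closed_walks_def nxt)
  qed
qed

lemma card_closed_walks:
  assumes d: "d \<ge> 1" and S: "finite S" and C: "\<And>u v. finite (C u v)"
  shows "finite (closed_walks S C d)"
    and "card (closed_walks S C d) = mat_trace S (mat_pow S (\<lambda>u v. card (C u v)) d)"
proof -
  note bij = bij_betw_closed_walks[OF d, of S C]
  note cw = card_walks[where C = C, OF S C]
  show "finite (closed_walks S C d)" using bij_betw_finite[OF bij] S cw by simp
  have "card (closed_walks S C d) = card (\<Union>u\<in>S. walks S C d u u)"
    by (rule bij_betw_same_card[OF bij])
  also have "\<dots> = (\<Sum>u\<in>S. card (walks S C d u u))"
  proof (rule card_UN_disjoint)
    \<comment> \<open>A nonempty list records its starting vertex; for \<open>d = 0\<close> the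
      empty list would be shared by all vertices.\<close>
    have "u = v" if "xs \<in> walks S C d u u" "xs \<in> walks S C d v v" for u v xs
    proof -
      have "xs \<noteq> []" using that(1) d by (auto simp: in_walks_iff)
      then show ?thesis using that by (auto simp: in_walks_iff nth_append)
    qed
    then show "\<forall>u\<in>S. \<forall>v\<in>S. u \<noteq> v \<longrightarrow> walks S C d u u \<inter> walks S C d v v = {}" by blast
  qed (use S cw in auto)
  finally show "card (closed_walks S C d) = mat_trace S (mat_pow S (\<lambda>u v. card (C u v)) d)"
    by (simp add: cw mat_trace_def)
qed

text \<open>\<open>None\<close> is the trivial card.\<close>
definition cards :: "nat list \<Rightarrow> nat list \<Rightarrow> nat list option set" where
  "cards u v = (if u = v then {None} else {}) \<union> (if u \<noteq> [] then Some ` embeddings u v else {})"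

lemma finite_embeddings: "finite (embeddings q r)"
  by (rule finite_subset[OF _ finite_lists_length_eq[of "{..<length r}" "length q - 1"]])
    (auto simp: embeddings_def)

lemma finite_cards: "finite (cards u v)"
  by (simp add: cards_def finite_embeddings)

lemma card_cards: "card (cards u v) = card_count u v"
proof -
  have "card (Some ` embeddings u v) = card (embeddings u v)" by (rule card_image) simp
  then show ?thesis
    by (auto simp: cards_def card_count_def finite_embeddings card_insert_if)
qed

lemma finite_ord_parts: "finite (ord_parts b)"
proof (rule finite_subset[OF _ finite_lists_length_le[of "{..b}" b]])
  have "length q \<le> sum_list q" if "\<forall>x\<in>set q. 0 < x" for q :: "nat list"
    using that by (induction q) auto
  then show "ord_parts b \<subseteq> {q. set q \<subseteq> {..b} \<and> length q \<le> b}"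
    by (auto simp: ord_parts_def intro: member_le_sum_list)
qed simp

abbreviation card_cycles :: "nat \<Rightarrow> nat \<Rightarrow> (nat \<Rightarrow> nat list \<times> nat list option) set" where
  "card_cycles b d \<equiv> closed_walks (ord_parts b) cards d"

lemma trA_eq_card:
  assumes "d \<ge> 1"
  shows "finite (card_cycles b d)" "card (card_cycles b d) = trA b d"
  using card_closed_walks[where C = cards, OF assms finite_ord_parts finite_cards]
  by (simp_all add: trA_def card_cards)

section \<open>Walks that never throw the topmost group\<close>

lemma cards_cases:
  assumes "c \<in> cards u v"
  obtains (trivial) "c = None" "u = v"
  | (throw) js where "c = Some js" "u \<noteq> []" "js \<in> embeddings u v"
  using assms by (auto simp: cards_def split: if_splits)

text \<open>If \<open>js\<close> is empty, a throw card throws the only group, so the top is not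
  carried along. Equality of the last parts says that no thrown ball joins the top group.\<close>

definition top_fixing :: "nat list \<Rightarrow> nat list \<Rightarrow> nat list option \<Rightarrow> bool" where
  "top_fixing u v c \<longleftrightarrow> u \<noteq> [] \<and> (case c of None \<Rightarrow> True
     | Some js \<Rightarrow> js \<noteq> [] \<and> last js = length v - 1 \<and> last u = last v)"

definition top_fixed :: "(nat \<Rightarrow> nat list \<times> nat list option) \<Rightarrow> bool" where
  "top_fixed x \<longleftrightarrow> (\<forall>t. top_fixing (fst (x t)) (fst (x (Suc t))) (snd (x t)))"

text \<open>The index appended to a throw card is the position of the new top part in the extended
  right partition, that is, the length of the old one.\<close>

definition add_top ::
  "nat \<Rightarrow> (nat \<Rightarrow> nat list \<times> nat list option) \<Rightarrow> nat \<Rightarrow> nat list \<times> nat list option" where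
  "add_top m x t = (fst (x t) @ [m], map_option (\<lambda>js. js @ [length (fst (x (Suc t)))]) (snd (x t)))"

definition remove_top ::
  "(nat \<Rightarrow> nat list \<times> nat list option) \<Rightarrow> nat \<Rightarrow> nat list \<times> nat list option" where
  "remove_top x t = (butlast (fst (x t)), map_option butlast (snd (x t)))"

text \<open>The appended index exceeds every index into \<open>v\<close> and its size condition
  reads \<open>m \<le> m\<close>, so it imposes nothing beyond what \<open>js\<close> must satisfy
  anyway.\<close>

lemma embeddings_snoc_iff:
  assumes "u \<noteq> []"
  shows "js @ [length v] \<in> embeddings (u @ [m]) (v @ [m]) \<longleftrightarrow> js \<in> embeddings u v"
proof -
  obtain k where k: "length u = Suc k" using assms by (cases u) auto
  have "(\<forall>j<Suc k. (u @ [m]) ! Suc j \<le> (v @ [m]) ! ((js @ [length v]) ! j))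
      \<longleftrightarrow> (\<forall>j<k. u ! Suc j \<le> v ! (js ! j))"
    if "length js = k" "\<forall>i\<in>set js. i < length v"
  proof -
    have "(\<forall>j<Suc k. Q j) \<longleftrightarrow> (\<forall>j<k. Q j) \<and> Q k" for Q by (auto simp: less_Suc_eq)
    moreover have "(u @ [m]) ! Suc j \<le> (v @ [m]) ! ((js @ [length v]) ! j) \<longleftrightarrow> u ! Suc j \<le> v ! (js ! j)"
      if "j < k" for j
      using that k \<open>length js = k\<close> \<open>\<forall>i\<in>set js. i < length v\<close> by (simp add: nth_append)
    moreover have "(u @ [m]) ! Suc k \<le> (v @ [m]) ! ((js @ [length v]) ! k)"
      using k \<open>length js = k\<close> by (simp add: nth_append)
    ultimately show ?thesis by simp
  qed
  then show ?thesis using k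
    by (auto simp: embeddings_def sorted_wrt_append less_Suc_eq)
qed

lemma cards_snoc_iff:
  assumes "c = None \<or> u \<noteq> []"
  shows "map_option (\<lambda>js. js @ [length v]) c \<in> cards (u @ [m]) (v @ [m]) \<longleftrightarrow> c \<in> cards u v"
  using assms embeddings_snoc_iff by (cases c) (auto simp: cards_def)

lemma closed_walksD:
  assumes "x \<in> closed_walks S C d"
  shows "x (t + d) = x t" "fst (x t) \<in> S" "snd (x t) \<in> C (fst (x t)) (fst (x (Suc t)))"
  using assms by (auto simp: closed_walks_def)

lemma add_top_closed_walk:
  assumes x: "x \<in> card_cycles i d" and i: "i < b"
  shows "add_top (b - i) x \<in> card_cycles b d \<and> top_fixed (add_top (b - i) x)"
proof
  note D = closed_walksD[OF x]
  have per: "add_top (b - i) x (t + d) = add_top (b - i) x t" for t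
    using D(1)[of t] D(1)[of "Suc t"] by (simp add: add_top_def)
  have "fst (add_top (b - i) x t) \<in> ord_parts b" for t
    using D(2)[of t] i by (auto simp: ord_parts_def add_top_def)
  moreover have "snd (add_top (b - i) x t)
      \<in> cards (fst (add_top (b - i) x t)) (fst (add_top (b - i) x (Suc t)))" for t
    unfolding add_top_def fst_conv snd_conv
    using D(3)[of t] by (subst cards_snoc_iff) (auto simp: cards_def split: if_splits)
  ultimately show "add_top (b - i) x \<in> card_cycles b d"
    using per by (simp add: closed_walks_def)
  show "top_fixed (add_top (b - i) x)"
    by (auto simp: top_fixed_def top_fixing_def add_top_def split: option.splits)
qed

lemma remove_top_add_top: "remove_top (add_top m x) = x"
  by (auto simp: remove_top_def add_top_def fun_eq_iff option.map_comp comp_def option.map_ident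
      intro!: prod_eqI)

text \<open>Each top-fixing card carries the size of the top group over to the next time, so a
  single constant \<open>m\<close> suffices to undo the deletion.\<close>

lemma remove_top_closed_walk:
  assumes x: "x \<in> card_cycles b d" and tf: "top_fixed x"
  defines "m \<equiv> last (fst (x 0))"
  shows "0 < m" "m \<le> b" "remove_top x \<in> card_cycles (b - m) d" "add_top m (remove_top x) = x"
proof -
  note D = closed_walksD[OF x]
  have tfD: "top_fixing (fst (x t)) (fst (x (Suc t))) (snd (x t))" for t
    using tf by (simp add: top_fixed_def)
  have ne: "fst (x t) \<noteq> []" for t using tfD[of t] by (simp add: top_fixing_def)
  have "last (fst (x (Suc t))) = last (fst (x t))" for t
    using D(3)[of t] tfD[of t] by (cases rule: cards_cases) (auto simp: top_fixing_def)
  then have last: "last (fst (x t)) = m" for t by (induction t) (auto simp: m_def)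
  have decomp: "fst (x t) = butlast (fst (x t)) @ [m]" for t
    using append_butlast_last_id[OF ne[of t]] last[of t] by simp
  show "0 < m" using D(2)[of 0] ne[of 0] by (auto simp: ord_parts_def m_def)
  have sum: "sum_list (butlast (fst (x t))) + m = b" for t
    using D(2)[of t] arg_cong[OF decomp[of t], of sum_list] by (simp add: ord_parts_def)
  show "m \<le> b" using sum[of 0] by simp
  show *: "add_top m (remove_top x) = x"
  proof
    fix t
    have "map_option (\<lambda>js. butlast js @ [length (butlast (fst (x (Suc t))))]) (snd (x t)) = snd (x t)"
      using tfD[of t] by (auto simp: top_fixing_def snoc_eq_iff_butlast split: option.splits)
    then show "add_top m (remove_top x) t = x t"
      using decomp[of t]
      by (auto simp: add_top_def remove_top_def option.map_comp comp_def intro!: prod_eqI)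
  qed
  have "remove_top x (t + d) = remove_top x t" for t
    using D(1)[of t] by (simp add: remove_top_def)
  moreover have "fst (remove_top x t) \<in> ord_parts (b - m)" for t
    using D(2)[of t] sum[of t] by (auto simp: ord_parts_def remove_top_def dest: in_set_butlastD)
  moreover have "snd (remove_top x t) \<in> cards (fst (remove_top x t)) (fst (remove_top x (Suc t)))" for t
  proof -
    \<comment> \<open>For a throw card, \<open>js\<close> is nonempty and one shorter than the left
      partition, which therefore keeps a part after the deletion.\<close>
    have "snd (remove_top x t) = None \<or> fst (remove_top x t) \<noteq> []"
    proof (cases "snd (x t)")
      case (Some js)
      then have "length js = length (fst (x t)) - 1" "js \<noteq> []"
        using D(3)[of t] tfD[of t] by (auto simp: cards_def top_fixing_def embeddings_def split: if_splits)
      then show ?thesis by (simp add: remove_top_def flip: length_0_conv)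
    qed (simp add: remove_top_def)
    then show ?thesis
      using cards_snoc_iff[of "snd (remove_top x t)" "fst (remove_top x t)" "fst (remove_top x (Suc t))" m]
        D(3)[of t] fun_cong[OF *, of t] fun_cong[OF *, of "Suc t"]
      by (metis add_top_def fst_conv snd_conv)
  qed
  ultimately show "remove_top x \<in> card_cycles (b - m) d"
    by (simp add: closed_walks_def)
qed

lemma card_top_fixed:
  assumes d: "d \<ge> 1"
  shows "card {x \<in> card_cycles b d. top_fixed x} = (\<Sum>i<b. trA i d)"
proof -
  have "bij_betw (\<lambda>(i, x). add_top (b - i) x) (SIGMA i:{..<b}. card_cycles i d)
      {x \<in> card_cycles b d. top_fixed x}"
  proof (rule bij_betw_byWitness[where f' = "\<lambda>x. (b - last (fst (x 0)), remove_top x)"])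
    show "\<forall>a\<in>SIGMA i:{..<b}. card_cycles i d.
        (b - last (fst ((case a of (i, x) \<Rightarrow> add_top (b - i) x) 0)),
          remove_top (case a of (i, x) \<Rightarrow> add_top (b - i) x)) = a"
      by (auto simp: remove_top_add_top) (auto simp: add_top_def)
    show "(\<lambda>(i, x). add_top (b - i) x) ` (SIGMA i:{..<b}. card_cycles i d)
        \<subseteq> {x \<in> card_cycles b d. top_fixed x}"
      using add_top_closed_walk by auto
    show "\<forall>x\<in>{x \<in> card_cycles b d. top_fixed x}.
        (case (b - last (fst (x 0)), remove_top x) of (i, x) \<Rightarrow> add_top (b - i) x) = x"
      using remove_top_closed_walk by auto
    show "(\<lambda>x. (b - last (fst (x 0)), remove_top x)) ` {x \<in> card_cycles b d. top_fixed x}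
        \<subseteq> (SIGMA i:{..<b}. card_cycles i d)"
    proof clarify
      fix x assume "x \<in> card_cycles b d" "top_fixed x"
      note R = remove_top_closed_walk[OF this]
      show "b - last (fst (x 0)) \<in> {..<b} \<and> remove_top x \<in> card_cycles (b - last (fst (x 0))) d"
        using R(1-3) by simp
    qed
  qed
  then have "card {x \<in> card_cycles b d. top_fixed x} = card (SIGMA i:{..<b}. card_cycles i d)"
    by (simp add: bij_betw_same_card)
  also have "\<dots> = (\<Sum>i<b. trA i d)" using trA_eq_card[OF d] by simp
  finally show ?thesis .
qed

section \<open>Recovering landing times from cards\<close>

text \<open>Groups are addressed by their index \<open>p\<close> in the left partition; \<open>advance\<close> gives the index in the
  right partition and is junk for the group that \<open>lands\<close>.\<close>
definition lands :: "nat list option \<Rightarrow> nat \<Rightarrow> bool" where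
  "lands c p \<longleftrightarrow> c \<noteq> None \<and> p = 0"

definition advance :: "nat list option \<Rightarrow> nat \<Rightarrow> nat" where
  "advance c p = (case c of None \<Rightarrow> p | Some js \<Rightarrow> js ! (p - 1))"

lemma advance_less:
  assumes "c \<in> cards u v" "p < length u" "\<not> lands c p"
  shows "advance c p < length v"
  using assms(1)
proof (cases rule: cards_cases)
  case (throw js)
  then have "p - 1 < length js" using assms by (auto simp: lands_def embeddings_def)
  then show ?thesis using throw by (auto simp: advance_def embeddings_def)
qed (use assms in \<open>auto simp: advance_def\<close>)

lemma advance_strict_mono:
  assumes "c \<in> cards u v" "p < p'" "p' < length u" "\<not> lands c p"
  shows "advance c p < advance c p'"
  using assms(1)
proof (cases rule: cards_cases)
  case (throw js)
  then have "p - 1 < p' - 1" "p' - 1 < length js" using assms by (auto simp: lands_def embeddings_def)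
  then show ?thesis using throw by (auto simp: advance_def embeddings_def sorted_wrt_iff_nth_less)
qed (use assms in \<open>auto simp: advance_def\<close>)

lemma part_le_advance:
  assumes "c \<in> cards u v" "p < length u" "\<not> lands c p"
  shows "u ! p \<le> v ! advance c p"
  using assms(1)
proof (cases rule: cards_cases)
  case (throw js)
  then obtain r where "p = Suc r" using assms by (cases p) (auto simp: lands_def)
  then show ?thesis using throw assms(2) by (auto simp: advance_def embeddings_def)
qed (use assms in \<open>auto simp: advance_def\<close>)

lemma sum_list_drop: "sum_list (drop p u) = (\<Sum>j\<in>{p..<length u}. u ! j)" for u :: "nat list"
proof -
  have "sum_list (drop p u) = (\<Sum>j\<in>{0..<length u - p}. u ! (p + j))"
    by (simp add: sum_list_sum_nth)
  also have "\<dots> = (\<Sum>j\<in>{p..<length u}. u ! j)"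
    by (rule sum.reindex_bij_witness[of _ "\<lambda>j. j - p" "\<lambda>j. p + j"]) auto
  finally show ?thesis .
qed

text \<open>The number of balls at or above a group that is not thrown cannot decrease, and stays the
  same only if nothing is thrown there.\<close>
lemma sum_drop_advance:
  assumes c: "c \<in> cards u v" and p: "p < length u" "\<not> lands c p" and v: "\<forall>y\<in>set v. 0 < y"
  shows "sum_list (drop p u) \<le> sum_list (drop (advance c p) v)"
    and "sum_list (drop p u) = sum_list (drop (advance c p) v) \<Longrightarrow> top_fixing u v c"
proof -
  define A where "A = advance c ` {p..<length u}"
  have ntl: "\<not> lands c j" if "j \<in> {p..<length u}" for j
    using that p by (auto simp: lands_def)
  have smono: "strict_mono_on {p..<length u} (advance c)"
    using ntl advance_strict_mono[OF c] by (auto intro!: strict_mono_onI)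
  then have inj: "inj_on (advance c) {p..<length u}" by (rule strict_mono_on_imp_inj_on)
  have mono: "advance c j \<le> advance c k" if "p \<le> j" "j \<le> k" "k < length u" for j k
    using that strict_mono_onD[OF smono, of j k] by (cases "j = k") auto
  have sub: "A \<subseteq> {advance c p..<length v}"
    using mono[of p] ntl advance_less[OF c] by (auto simp: A_def)
  have le: "u ! j \<le> v ! advance c j" if "j \<in> {p..<length u}" for j
    using that part_le_advance[OF c] ntl by auto
  have sumA: "(\<Sum>i\<in>A. v ! i) = (\<Sum>j\<in>{p..<length u}. v ! advance c j)"
    unfolding A_def using inj by (simp add: sum.reindex)
  have le1: "(\<Sum>j\<in>{p..<length u}. u ! j) \<le> (\<Sum>i\<in>A. v ! i)"
    unfolding sumA by (rule sum_mono[OF le])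
  have le2: "(\<Sum>i\<in>A. v ! i) \<le> (\<Sum>i\<in>{advance c p..<length v}. v ! i)"
    by (rule sum_mono2[OF _ sub]) auto
  show "sum_list (drop p u) \<le> sum_list (drop (advance c p) v)"
    unfolding sum_list_drop using le1 le2 by (rule order_trans)
  assume "sum_list (drop p u) = sum_list (drop (advance c p) v)"
  then have eq1: "(\<Sum>j\<in>{p..<length u}. u ! j) = (\<Sum>j\<in>{p..<length u}. v ! advance c j)"
    and eq2: "(\<Sum>i\<in>A. v ! i) = (\<Sum>i\<in>{advance c p..<length v}. v ! i)"
    unfolding sum_list_drop using le1 le2 sumA by simp_all
  have vlen: "advance c p < length v" using advance_less[OF c p] .
  \<comment> \<open>A part of the tail of \<open>v\<close> missed by \<open>advance\<close> is
    positive and would make the comparison of sums strict. Hence the top index of \<open>v\<close>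
    is attained, by monotonicity from the top index of \<open>u\<close>.\<close>
  have Aall: "A = {advance c p..<length v}"
  proof (rule ccontr)
    assume "A \<noteq> {advance c p..<length v}"
    then obtain i where i: "i \<in> {advance c p..<length v} - A" using sub by blast
    have "(\<Sum>i\<in>A. v ! i) < (\<Sum>i\<in>{advance c p..<length v}. v ! i)"
      by (rule sum_strict_mono2[OF _ sub i]) (use i v in auto)
    then show False using eq2 by simp
  qed
  have "length v - 1 \<in> A" using vlen unfolding Aall by auto
  then obtain j where j: "j \<in> {p..<length u}" "advance c j = length v - 1" by (auto simp: A_def)
  have "advance c j \<le> advance c (length u - 1)" using j(1) by (intro mono) auto
  moreover have "advance c (length u - 1) < length v"
    using p by (intro advance_less[OF c] ntl) auto
  ultimately have top: "advance c (length u - 1) = length v - 1" using j(2) by simp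
  \<comment> \<open>Equal sums of termwise comparable parts leave no room for a strict inequality,
    in particular at the top.\<close>
  have "u ! (length u - 1) = v ! advance c (length u - 1)"
  proof (rule ccontr)
    assume ne: "u ! (length u - 1) \<noteq> v ! advance c (length u - 1)"
    have m: "length u - 1 \<in> {p..<length u}" using p by auto
    have "(\<Sum>j\<in>{p..<length u}. u ! j) < (\<Sum>j\<in>{p..<length u}. v ! advance c j)"
      by (rule sum_strict_mono_ex1) (use le m ne order_le_imp_less_or_eq[OF le[OF m]] in auto)
    then show False using eq1 by simp
  qed
  then have lst: "last u = last v" using p vlen top by (simp add: last_conv_nth flip: length_greater_0_conv)
  show "top_fixing u v c"
    using c
  proof (cases rule: cards_cases)
    case (throw js)
    then have "js \<noteq> []" "length js = length u - 1" using p by (auto simp: lands_def embeddings_def)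
    then show ?thesis using throw top lst by (simp add: top_fixing_def advance_def last_conv_nth)
  qed (use p in \<open>auto simp: top_fixing_def\<close>)
qed

text \<open>The group is followed only until it is first thrown, so \<open>advance\<close> is never
  applied where it is junk, and \<open>h\<close> is unique.\<close>

primrec lands_after ::
  "(nat \<Rightarrow> nat list \<times> nat list option) \<Rightarrow> nat \<Rightarrow> nat \<Rightarrow> nat \<Rightarrow> bool" where
  "lands_after x 0 t p \<longleftrightarrow> lands (snd (x t)) p"
| "lands_after x (Suc h) t p \<longleftrightarrow>
     \<not> lands (snd (x t)) p \<and> lands_after x h (Suc t) (advance (snd (x t)) p)"

lemma lands_after_unique: "lands_after x h t p \<Longrightarrow> lands_after x h' t p \<Longrightarrow> h = h'"
proof (induction h arbitrary: t p h')
  case 0 then show ?case by (cases h') auto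
next
  case (Suc h) then show ?case by (cases h') auto
qed

text \<open>Only index 0 can land, and \<open>advance\<close> keeps the order of the other groups,
  so a higher group always has a lower one that must be thrown before it.\<close>

lemma lands_after_strict_mono:
  assumes x: "x \<in> closed_walks S cards d"
  shows "lands_after x h' t p' \<Longrightarrow> lands_after x h t p \<Longrightarrow> p < p' \<Longrightarrow> p' < length (fst (x t)) \<Longrightarrow> h < h'"
proof (induction h' arbitrary: t p p' h)
  case 0 then show ?case by (simp add: lands_def)
next
  case (Suc h')
  show ?case
  proof (cases h)
    case (Suc k)
    note D = closed_walksD(3)[OF x, of t]
    have "k < h'"
      using Suc.prems Suc advance_strict_mono[OF D] advance_less[OF D]
      by (intro Suc.IH[of "Suc t" "advance (snd (x t)) p'" k "advance (snd (x t)) p"]) auto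
    then show ?thesis using Suc by simp
  qed simp
qed

text \<open>For a group that never lands, the number of balls at or above it is nondecreasing and at
  most \<open>b\<close>, hence eventually constant. From then on every card fixes the top group, and
  by periodicity so do all cards.\<close>

lemma lands_after_exists:
  assumes x: "x \<in> card_cycles b d" and d: "d \<ge> 1" and ntf: "\<not> top_fixed x"
    and p: "p < length (fst (x t))"
  shows "\<exists>h. lands_after x h t p"
proof (rule ccontr)
  assume no: "\<nexists>h. lands_after x h t p"
  note D = closed_walksD[OF x]
  define P where "P = rec_nat p (\<lambda>k q. advance (snd (x (t + k))) q)"
  have P0: "P 0 = p" and PS: "P (Suc k) = advance (snd (x (t + k))) (P k)" for k
    by (simp_all add: P_def)
  \<comment> \<open>\<open>P k\<close> is the index of the group after \<open>k\<close> steps, and \<open>a k\<close> the number of balls at or above it.\<close>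
  have "\<not> lands_after x h (t + k) (P k)" for h k
  proof (induction k arbitrary: h)
    case 0 then show ?case using no P0 by simp
  next
    case (Suc k)
    have "\<not> lands_after x (Suc h) (t + k) (P k)" "\<not> lands_after x 0 (t + k) (P k)" by (rule Suc)+
    then show ?case by (simp add: PS)
  qed
  from this[of 0] have nl: "\<not> lands (snd (x (t + k))) (P k)" for k by simp
  have lt: "P k < length (fst (x (t + k)))" for k
  proof (induction k)
    case (Suc k)
    show ?case using advance_less[OF D(3) Suc nl] by (simp add: PS)
  qed (use p P0 in simp)
  define a where "a k = sum_list (drop (P k) (fst (x (t + k))))" for k
  have pos: "\<forall>y\<in>set (fst (x s)). 0 < y" for s using D(2)[of s] by (simp add: ord_parts_def)
  have a_le: "a k \<le> a (Suc k)" and a_eq: "a k = a (Suc k) \<Longrightarrow>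
      top_fixing (fst (x (t + k))) (fst (x (Suc (t + k)))) (snd (x (t + k)))" for k
    using sum_drop_advance[OF D(3) lt nl pos, of k] by (simp_all add: a_def PS)
  have "a k \<le> b" for k
  proof -
    have "sum_list (take (P k) (fst (x (t + k)))) + a k = sum_list (fst (x (t + k)))"
      unfolding a_def by (metis append_take_drop_id sum_list_append)
    then show ?thesis using D(2)[of "t + k"] by (simp add: ord_parts_def)
  qed
  then obtain K where K: "a k \<le> a K" for k
    using ex_has_greatest_nat[of "\<lambda>_. True" 0 a "Suc b"] by (auto simp: less_Suc_eq_le)
  have "a k = a (Suc k)" if "K \<le> k" for k
    using that K a_le lift_Suc_mono_le[of a K, OF a_le] by (metis le_antisym le_trans)
  then have fixing: "top_fixing (fst (x (t + k))) (fst (x (Suc (t + k)))) (snd (x (t + k)))"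
    if "K \<le> k" for k using a_eq that by blast
  have "top_fixing (fst (x s)) (fst (x (Suc s))) (snd (x s))" for s
  proof -
    \<comment> \<open>Chosen so that \<open>t + k\<close> is \<open>s\<close> plus a multiple of
      \<open>d\<close> and \<open>k \<ge> K\<close>; the added \<open>K + t\<close> periods keep the
      subtraction of \<open>t\<close> exact.\<close>
    define k where "k = s + (K + t) * d - t"
    have "K + t \<le> (K + t) * d" using d by simp
    then have k: "K \<le> k" "t + k = s + (K + t) * d" unfolding k_def by linarith+
    have "x (s + (K + t) * d) = x s" "x (Suc s + (K + t) * d) = x (Suc s)"
      by (rule periodic_mult[of x, OF D(1)])+
    then show ?thesis using fixing[OF k(1)] by (simp add: k(2))
  qed
  then show False using ntf by (simp add: top_fixed_def)
qed

text \<open>The landing times of the groups on the left of a card, computed from those on its right.\<close>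
definition pull :: "nat list option \<Rightarrow> nat list \<Rightarrow> nat list" where
  "pull c E = (case c of None \<Rightarrow> map Suc E | Some js \<Rightarrow> 0 # map (\<lambda>i. Suc (E ! i)) js)"

text \<open>A recursion from \<open>Suc t\<close> back to \<open>t\<close> without an initial value:
  neither existence nor uniqueness of \<open>E\<close> is automatic.\<close>

definition landing_times ::
  "(nat \<Rightarrow> nat list \<times> nat list option) \<Rightarrow> (nat \<Rightarrow> nat list) \<Rightarrow> bool" where
  "landing_times x E \<longleftrightarrow> (\<forall>t. length (E t) = length (fst (x t)) \<and> sorted_wrt (<) (E t)
     \<and> E t = pull (snd (x t)) (E (Suc t)))"

lemma pull_nth:
  assumes "c \<in> cards u v" "length E = length v"
  shows "length (pull c E) = length u"
    and "p < length u \<Longrightarrow> pull c E ! p = (if lands c p then 0 else Suc (E ! advance c p))"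
proof -
  show "length (pull c E) = length u"
    using assms(1) by (cases rule: cards_cases) (use assms(2) in \<open>auto simp: pull_def embeddings_def\<close>)
  assume p: "p < length u"
  show "pull c E ! p = (if lands c p then 0 else Suc (E ! advance c p))"
    using assms(1)
  proof (cases rule: cards_cases)
    case (throw js)
    then show ?thesis using p
      by (cases p) (auto simp: pull_def lands_def advance_def embeddings_def)
  qed (use assms(2) p in \<open>auto simp: pull_def lands_def advance_def\<close>)
qed

text \<open>A zero entry occurs only for a throw card, which settles the kind of card; the indices
  are then the positions of known values in the repetition-free list \<open>E\<close>.\<close>

lemma pull_inject:
  assumes c: "c \<in> cards u v" "c' \<in> cards u v" and E: "distinct E" "length E = length v"
    and eq: "pull c E = pull c' E"
  shows "c = c'"
proof -
  have ne: "map Suc E \<noteq> 0 # ys" "0 # ys \<noteq> map Suc E" for ys by (cases E; simp)+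
  show ?thesis
  proof (cases c)
    case None
    then show ?thesis using eq ne by (cases c') (simp_all add: pull_def)
  next
    case (Some js)
    then obtain js' where js': "c' = Some js'" using eq ne by (cases c') (simp_all add: pull_def)
    have "map Suc (map ((!) E) js) = map Suc (map ((!) E) js')"
      using eq Some js' by (simp add: pull_def comp_def)
    then have "map ((!) E) js = map ((!) E) js'" by (rule map_injective) simp
    moreover have "set js \<union> set js' \<subseteq> {..<length E}"
      using c Some js' E(2) by (auto simp: cards_def embeddings_def split: if_splits)
    then have "inj_on ((!) E) (set js \<union> set js')"
      using E(1) by (intro inj_on_nth) auto
    ultimately show ?thesis using Some js' inj_on_map_eq_map by blast
  qed
qed

text \<open>The induction is on the entry \<open>h\<close> itself: one step later the same group
  carries \<open>h - 1\<close>, until a card throws it and both solutions are forced to be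
  0.\<close>

lemma landing_times_unique:
  assumes x: "x \<in> closed_walks S cards d" and E: "landing_times x E" and E': "landing_times x E'"
  shows "E = E'"
proof
  fix t
  have len: "length (E t) = length (fst (x t))" "length (E' t) = length (fst (x t))" for t
    using E E' unfolding landing_times_def by blast+
  note D = closed_walksD(3)[OF x]
  have nth: "E t ! p = (if lands (snd (x t)) p then 0 else Suc (E (Suc t) ! advance (snd (x t)) p))"
    "E' t ! p = (if lands (snd (x t)) p then 0 else Suc (E' (Suc t) ! advance (snd (x t)) p))"
    if "p < length (fst (x t))" for t p
  proof -
    have Et: "E t = pull (snd (x t)) (E (Suc t))" "E' t = pull (snd (x t)) (E' (Suc t))"
      using E E' unfolding landing_times_def by blast+
    show "E t ! p = (if lands (snd (x t)) p then 0 else Suc (E (Suc t) ! advance (snd (x t)) p))"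
      "E' t ! p = (if lands (snd (x t)) p then 0 else Suc (E' (Suc t) ! advance (snd (x t)) p))"
      unfolding Et using len by (simp_all add: pull_nth(2)[OF D _ that])
  qed
  have "p < length (fst (x t)) \<Longrightarrow> E t ! p = h \<Longrightarrow> E' t ! p = h" for h t p
  proof (induction h arbitrary: t p)
    case 0
    then show ?case using nth[OF 0(1)] by (auto split: if_splits)
  next
    case (Suc h)
    then have nl: "\<not> lands (snd (x t)) p" and "E (Suc t) ! advance (snd (x t)) p = h"
      using nth(1)[OF Suc.prems(1)] by (auto split: if_splits)
    then have "E' (Suc t) ! advance (snd (x t)) p = h"
      using advance_less[OF D Suc.prems(1) nl] by (intro Suc.IH) auto
    then show ?case using nth(2)[OF Suc.prems(1)] nl by simp
  qed
  then show "E t = E' t" using len by (intro nth_equalityI) auto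
qed

text \<open>The solution is the waiting time of each group until it is thrown, defined everywhere by
  \<open>lands_after_exists\<close> and increasing because lower groups land first.\<close>

lemma landing_times_exists:
  assumes x: "x \<in> card_cycles b d" and d: "d \<ge> 1" and ntf: "\<not> top_fixed x"
  shows "\<exists>E. landing_times x E"
proof -
  define L where "L t p = (THE h. lands_after x h t p)" for t p
  note D = closed_walksD(3)[OF x]
  have Leq: "L t p = h" if "lands_after x h t p" for h t p
    unfolding L_def by (rule the_equality) (use that lands_after_unique in blast)+
  have L: "lands_after x (L t p) t p" if "p < length (fst (x t))" for t p
    using lands_after_exists[OF x d ntf that] Leq by metis
  define E where "E t = map (L t) [0..<length (fst (x t))]" for t
  have "sorted_wrt (<) (E t)" for t
    using lands_after_strict_mono[OF x L L] by (auto simp: E_def sorted_wrt_iff_nth_less)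
  moreover have "E t = pull (snd (x t)) (E (Suc t))" for t
  proof (rule nth_equalityI)
    have lenE: "length (E (Suc t)) = length (fst (x (Suc t)))" by (simp add: E_def)
    show "length (E t) = length (pull (snd (x t)) (E (Suc t)))"
      using pull_nth(1)[OF D lenE] by (simp add: E_def)
    fix p assume "p < length (E t)"
    then have p: "p < length (fst (x t))" by (simp add: E_def)
    show "E t ! p = pull (snd (x t)) (E (Suc t)) ! p"
    proof (cases "lands (snd (x t)) p")
      case True
      then have "L t p = 0" by (intro Leq) simp
      then show ?thesis using True pull_nth(2)[OF D lenE p] p by (simp add: E_def)
    next
      case False
      note adv = advance_less[OF D p False]
      have "L t p = Suc (L (Suc t) (advance (snd (x t)) p))"
        using False L[OF adv] by (intro Leq) simp
      then show ?thesis using False pull_nth(2)[OF D lenE p] p adv by (simp add: E_def)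
    qed
  qed
  moreover have "length (E t) = length (fst (x t))" for t by (simp add: E_def)
  ultimately have "landing_times x E" unfolding landing_times_def by blast
  then show ?thesis by blast
qed

text \<open>Infinite descent: the landing time of a fixed top group would drop by one at every
  step.\<close>

lemma landing_times_not_top_fixed:
  assumes E: "landing_times x E"
  shows "\<not> top_fixed x"
proof
  assume tf: "top_fixed x"
  have len: "length (E t) = length (fst (x t))" and Et: "E t = pull (snd (x t)) (E (Suc t))" for t
    using E unfolding landing_times_def by blast+
  have tfD: "top_fixing (fst (x t)) (fst (x (Suc t))) (snd (x t))" for t
    using tf by (simp add: top_fixed_def)
  have ne: "E t \<noteq> []" for t
    using tfD[of t] len[of t] by (auto simp: top_fixing_def)
  have step: "last (E t) = Suc (last (E (Suc t)))" for t
  proof (cases "snd (x t)")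
    case None
    then show ?thesis using Et[of t] ne[of "Suc t"] by (simp add: pull_def last_map)
  next
    case (Some js)
    then have "js \<noteq> []" "last js = length (E (Suc t)) - 1"
      using tfD[of t] len[of "Suc t"] by (auto simp: top_fixing_def)
    then show ?thesis using Et[of t] ne[of "Suc t"] Some
      by (simp add: pull_def last_map last_conv_nth[of "E (Suc t)"])
  qed
  have "last (E 0) = k + last (E k)" for k
  proof (induction k)
    case (Suc k)
    then show ?case using step[of k] by simp
  qed simp
  from this[of "Suc (last (E 0))"] show False by simp
qed

section \<open>States encoded by landing times and group sizes\<close>

definition support_list :: "nat multiset \<Rightarrow> nat list" where
  "support_list \<sigma> = sorted_list_of_set (set_mset \<sigma>)"

definition parts :: "nat multiset \<Rightarrow> nat list" where
  "parts \<sigma> = map (count \<sigma>) (support_list \<sigma>)"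

lemma support_list [simp]:
  "set (support_list \<sigma>) = set_mset \<sigma>" "distinct (support_list \<sigma>)" "sorted_wrt (<) (support_list \<sigma>)"
  by (simp_all add: support_list_def)

lemma length_parts [simp]: "length (parts \<sigma>) = length (support_list \<sigma>)"
  by (simp add: parts_def)

lemma parts_in_ord_parts: "parts \<sigma> \<in> ord_parts (size \<sigma>)"
  by (auto simp: ord_parts_def parts_def size_multiset_overloaded_eq sum_list_distinct_conv_sum_set)

lemma support_list_eqI:
  assumes "sorted_wrt (<) E" "set E = set_mset \<sigma>"
  shows "support_list \<sigma> = E"
  using assms strict_sorted_equal[of "support_list \<sigma>" E] by simp

lemma parts_inject:
  assumes "support_list \<sigma> = support_list \<tau>" "parts \<sigma> = parts \<tau>"
  shows "\<sigma> = \<tau>"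
proof (rule multiset_eqI)
  fix h
  have "set_mset \<sigma> = set_mset \<tau>" using support_list(1) assms(1) by metis
  moreover have "\<forall>h\<in>set (support_list \<sigma>). count \<sigma> h = count \<tau> h"
    using assms by (simp add: parts_def)
  ultimately show "count \<sigma> h = count \<tau> h"
    by (cases "h \<in># \<sigma>") (auto simp: count_eq_zero_iff[THEN iffD2])
qed

lemma parts_surj:
  assumes E: "sorted_wrt (<) E" "length E = length u" and u: "\<forall>y\<in>set u. 0 < y"
  shows "\<exists>\<sigma>. support_list \<sigma> = E \<and> parts \<sigma> = u"
proof -
  define \<sigma> where "\<sigma> = (\<Sum>p<length E. replicate_mset (u ! p) (E ! p))"
  have dist: "distinct E" using E(1) by (simp add: strict_sorted_iff)
  have cnt: "count \<sigma> h = (\<Sum>p<length E. if E ! p = h then u ! p else 0)" for h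
    unfolding \<sigma>_def by (auto simp: count_sum intro!: sum.cong)
  have cnt_nth: "count \<sigma> (E ! q) = u ! q" if "q < length E" for q
  proof -
    have "count \<sigma> (E ! q) = (\<Sum>p<length E. if p = q then u ! p else 0)"
      unfolding cnt using that dist by (intro sum.cong refl) (auto simp: nth_eq_iff_index_eq)
    then show ?thesis using that by simp
  qed
  have "set_mset \<sigma> = set E"
  proof (intro equalityI subsetI)
    fix h assume "h \<in># \<sigma>"
    then have "count \<sigma> h \<noteq> 0" by simp
    then obtain p where "p < length E" "E ! p = h" unfolding cnt
      by (auto elim!: sum.not_neutral_contains_not_neutral split: if_splits)
    then show "h \<in> set E" by auto
  next
    fix h assume "h \<in> set E"
    then obtain p where p: "p < length E" "h = E ! p" by (auto simp: in_set_conv_nth)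
    then have "0 < count \<sigma> h" using cnt_nth[OF p(1)] u E(2) by simp
    then show "h \<in># \<sigma>" by simp
  qed
  then have supp: "support_list \<sigma> = E" using E(1) by (intro support_list_eqI) simp_all
  moreover have "parts \<sigma> = u"
    unfolding parts_def supp using cnt_nth E(2) by (intro nth_equalityI) auto
  ultimately show ?thesis by blast
qed

lemma card_imp_landing_step:
  assumes c: "c \<in> cards (parts \<sigma>) (parts \<tau>)" and E: "support_list \<sigma> = pull c (support_list \<tau>)"
  shows "count \<sigma> (Suc h) \<le> count \<tau> h"
proof (cases "Suc h \<in># \<sigma>")
  case True
  then obtain p where p: "p < length (support_list \<sigma>)" "support_list \<sigma> ! p = Suc h"
    by (metis in_set_conv_nth support_list(1))
  then have p': "p < length (parts \<sigma>)" by simp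
  have "pull c (support_list \<tau>) ! p
      = (if lands c p then 0 else Suc (support_list \<tau> ! advance c p))"
    by (rule pull_nth(2)[OF c _ p']) simp
  then have nl: "\<not> lands c p" and h: "support_list \<tau> ! advance c p = h"
    using p E by (auto split: if_splits)
  have "parts \<sigma> ! p \<le> parts \<tau> ! advance c p" by (rule part_le_advance[OF c p' nl])
  then show ?thesis using p h advance_less[OF c p' nl] by (simp add: parts_def)
qed (simp add: not_in_iff)

text \<open>The entry 0 decides the kind of card. Without it, \<open>\<sigma>\<close> is contained
  in \<open>image_mset Suc \<tau>\<close> and equal sizes force equality, which is the trivial card.
  With it, the bottom group is thrown, and the group landing at \<open>Suc h\<close> is sent to the
  position of \<open>h\<close> among the landing times of \<open>\<tau>\<close>.\<close>

lemma landing_step_imp_card: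
  assumes size: "size \<sigma> = size \<tau>" and le: "\<And>h. count \<sigma> (Suc h) \<le> count \<tau> h"
  shows "\<exists>c\<in>cards (parts \<sigma>) (parts \<tau>). support_list \<sigma> = pull c (support_list \<tau>)"
proof (cases "0 \<in># \<sigma>")
  case False
  have "\<sigma> \<subseteq># image_mset Suc \<tau>"
  proof (rule mset_subset_eqI)
    fix h show "count \<sigma> h \<le> count (image_mset Suc \<tau>) h"
      using le False by (cases h) (auto simp: not_in_iff)
  qed
  then have \<sigma>: "\<sigma> = image_mset Suc \<tau>" using size
    by (metis mset_subset_size nat_less_le size_image_mset subset_mset.le_imp_less_or_eq)
  have "support_list \<sigma> = map Suc (support_list \<tau>)"
    by (rule support_list_eqI) (simp_all add: sorted_wrt_map \<sigma>)
  moreover have "parts \<sigma> = parts \<tau>"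
    unfolding parts_def calculation by (simp add: \<sigma>)
  ultimately show ?thesis by (intro bexI[of _ None]) (auto simp: pull_def cards_def)
next
  case True
  define F where "F = support_list \<tau>"
  define L where "L = sorted_list_of_set {h. Suc h \<in># \<sigma>}"
  have "finite {h. Suc h \<in># \<sigma>}"
    by (rule finite_imageD[of Suc]) (auto intro: finite_subset[of _ "set_mset \<sigma>"])
  then have L: "set L = {h. Suc h \<in># \<sigma>}" "sorted_wrt (<) L" by (simp_all add: L_def)
  have supp: "support_list \<sigma> = 0 # map Suc L"
  proof (rule support_list_eqI)
    have "h \<in> Suc ` {h. Suc h \<in># \<sigma>}" if "h \<in># \<sigma>" "h \<noteq> 0" for h
      using that by (cases h) auto
    then show "set (0 # map Suc L) = set_mset \<sigma>" using True by (auto simp: L)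
  qed (use L in \<open>simp add: sorted_wrt_map\<close>)
  have "h \<in># \<tau>" if "h \<in> set L" for h
    using le[of h] that L by (simp flip: count_greater_zero_iff)
  then have "\<forall>h\<in>set L. \<exists>i<length F. F ! i = h"
    by (metis F_def in_set_conv_nth support_list(1))
  then obtain f where f: "\<And>h. h \<in> set L \<Longrightarrow> f h < length F \<and> F ! f h = h" by metis
  have F: "sorted_wrt (<) F" by (simp add: F_def)
  have f_less: "f h < f h'" if "h \<in> set L" "h' \<in> set L" "h < h'" for h h'
  proof (rule ccontr)
    assume "\<not> f h < f h'"
    then have "F ! f h' \<le> F ! f h"
      using f[OF that(1)] sorted_wrt_nth_less[OF F, of "f h'" "f h"] by (cases "f h' = f h") auto
    then show False using f that by simp
  qed
  have "map f L \<in> embeddings (parts \<sigma>) (parts \<tau>)"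
    unfolding embeddings_def
  proof (intro CollectI conjI)
    show "sorted_wrt (<) (map f L)"
      using L(2) f_less by (auto simp: sorted_wrt_map intro: sorted_wrt_mono_rel[of L "(<)"])
    show "\<forall>i\<in>set (map f L). i < length (parts \<tau>)" using f by (auto simp: F_def)
    show "length (map f L) = length (parts \<sigma>) - 1" by (simp add: supp)
    show "\<forall>j<length (parts \<sigma>) - 1. parts \<sigma> ! (j + 1) \<le> parts \<tau> ! (map f L ! j)"
    proof clarify
      fix j assume "j < length (parts \<sigma>) - 1"
      then have j: "j < length L" by (simp add: supp)
      then have "parts \<sigma> ! (j + 1) = count \<sigma> (Suc (L ! j))" by (simp add: parts_def supp)
      also have "\<dots> \<le> count \<tau> (L ! j)" by (rule le)
      also have "\<dots> = parts \<tau> ! (map f L ! j)"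
        using f[of "L ! j"] j by (simp add: parts_def F_def)
      finally show "parts \<sigma> ! (j + 1) \<le> parts \<tau> ! (map f L ! j)" .
    qed
  qed
  moreover have "parts \<sigma> \<noteq> []" by (simp add: parts_def supp)
  moreover have "support_list \<sigma> = pull (Some (map f L)) (support_list \<tau>)"
    using f by (simp add: supp pull_def F_def)
  ultimately show ?thesis by (intro bexI[of _ "Some (map f L)"]) (auto simp: cards_def)
qed

text \<open>The description is proper on \<open>landing_seqs\<close>: existence is
  \<open>landing_step_imp_card\<close>, uniqueness is \<open>pull_inject\<close>.\<close>

definition card_seq ::
  "(nat \<Rightarrow> nat multiset) \<Rightarrow> nat \<Rightarrow> nat list \<times> nat list option" where
  "card_seq \<sigma> t = (parts (\<sigma> t), THE c. c \<in> cards (parts (\<sigma> t)) (parts (\<sigma> (Suc t)))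
     \<and> support_list (\<sigma> t) = pull c (support_list (\<sigma> (Suc t))))"

lemma card_seq_eqI:
  assumes "c \<in> cards (parts (\<sigma> t)) (parts (\<sigma> (Suc t)))"
    "support_list (\<sigma> t) = pull c (support_list (\<sigma> (Suc t)))"
  shows "card_seq \<sigma> t = (parts (\<sigma> t), c)"
proof -
  have "c' = c" if "c' \<in> cards (parts (\<sigma> t)) (parts (\<sigma> (Suc t)))"
    "support_list (\<sigma> t) = pull c' (support_list (\<sigma> (Suc t)))" for c'
    using that assms pull_inject[of c' _ _ c "support_list (\<sigma> (Suc t))"] by simp
  then show ?thesis unfolding card_seq_def using assms by (auto intro!: the_equality)
qed

lemma card_seq_closed_walk:
  assumes \<sigma>: "\<sigma> \<in> landing_seqs b d"
  shows "card_seq \<sigma> \<in> card_cycles b d" "landing_times (card_seq \<sigma>) (\<lambda>t. support_list (\<sigma> t))"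
proof -
  note D = landing_seqsD[OF \<sigma>]
  have "\<exists>c. c \<in> cards (parts (\<sigma> t)) (parts (\<sigma> (Suc t)))
      \<and> support_list (\<sigma> t) = pull c (support_list (\<sigma> (Suc t)))" for t
    using landing_step_imp_card[of "\<sigma> t" "\<sigma> (Suc t)"] D by auto
  then obtain c where c: "\<And>t. c t \<in> cards (parts (\<sigma> t)) (parts (\<sigma> (Suc t)))"
    "\<And>t. support_list (\<sigma> t) = pull (c t) (support_list (\<sigma> (Suc t)))"
    by metis
  have eq: "card_seq \<sigma> t = (parts (\<sigma> t), c t)" for t by (intro card_seq_eqI c)
  have "card_seq \<sigma> (t + d) = card_seq \<sigma> t" for t
    using D(1)[of t] D(1)[of "Suc t"] by (simp add: card_seq_def)
  then show "card_seq \<sigma> \<in> card_cycles b d"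
    using c(1) parts_in_ord_parts[of "\<sigma> _"] D(2) by (simp add: closed_walks_def eq)
  show "landing_times (card_seq \<sigma>) (\<lambda>t. support_list (\<sigma> t))"
    unfolding landing_times_def eq fst_conv snd_conv by (intro allI conjI c(2)) simp_all
qed

text \<open>A state is the same as its landing times with its group sizes. The walk shows the sizes
  as its left partitions and determines the times by uniqueness; conversely, solving for the times
  and combining them with the partitions builds a preimage.\<close>

lemma bij_betw_card_seq:
  assumes d: "d \<ge> 1"
  shows "bij_betw card_seq (landing_seqs b d) {x \<in> card_cycles b d. \<not> top_fixed x}"
proof (rule bij_betw_imageI)
  show "inj_on card_seq (landing_seqs b d)"
  proof (rule inj_onI)
    fix \<sigma> \<tau> assume \<sigma>: "\<sigma> \<in> landing_seqs b d" and \<tau>: "\<tau> \<in> landing_seqs b d"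
      and eq: "card_seq \<sigma> = card_seq \<tau>"
    have "(\<lambda>t. support_list (\<sigma> t)) = (\<lambda>t. support_list (\<tau> t))"
      using landing_times_unique card_seq_closed_walk[OF \<sigma>] card_seq_closed_walk[OF \<tau>] eq by metis
    then have "support_list (\<sigma> t) = support_list (\<tau> t)" for t by (rule fun_cong)
    moreover have "parts (\<sigma> t) = parts (\<tau> t)" for t
      using fun_cong[OF eq, of t] by (simp add: card_seq_def)
    ultimately show "\<sigma> = \<tau>" by (auto intro: parts_inject)
  qed
  show "card_seq ` landing_seqs b d = {x \<in> card_cycles b d. \<not> top_fixed x}"
  proof (intro equalityI subsetI)
    fix x assume "x \<in> {x \<in> card_cycles b d. \<not> top_fixed x}"
    then have x: "x \<in> card_cycles b d" "\<not> top_fixed x" by auto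
    note D = closed_walksD[OF x(1)]
    obtain E where E: "landing_times x E" using landing_times_exists[OF x(1) d x(2)] by blast
    then have ED: "length (E t) = length (fst (x t))" "sorted_wrt (<) (E t)"
      "E t = pull (snd (x t)) (E (Suc t))" for t
      unfolding landing_times_def by blast+
    \<comment> \<open>Shifting a solution by the period of \<open>x\<close> solves the recursion for
      the same walk, so uniqueness makes \<open>E\<close> periodic.\<close>
    have "landing_times x (\<lambda>t. E (t + d))"
      unfolding landing_times_def
    proof (intro allI conjI)
      fix t
      have xt: "x (t + d) = x t" by (rule D(1))
      show "length (E (t + d)) = length (fst (x t))" using ED(1)[of "t + d"] by (simp add: xt)
      show "sorted_wrt (<) (E (t + d))" by (rule ED(2))
      show "E (t + d) = pull (snd (x t)) (E (Suc t + d))" using ED(3)[of "t + d"] by (simp add: xt)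
    qed
    then have perE: "E (t + d) = E t" for t
      using landing_times_unique[OF x(1) _ E] by (metis (full_types))
    have pos: "\<forall>y\<in>set (fst (x t)). 0 < y" for t using D(2)[of t] by (simp add: ord_parts_def)
    have "\<exists>\<sigma>. support_list \<sigma> = E t \<and> parts \<sigma> = fst (x t)" for t
      by (rule parts_surj[OF ED(2) ED(1) pos])
    then obtain \<sigma> where \<sigma>: "\<And>t. support_list (\<sigma> t) = E t" "\<And>t. parts (\<sigma> t) = fst (x t)"
      by metis
    have c: "snd (x t) \<in> cards (parts (\<sigma> t)) (parts (\<sigma> (Suc t)))"
      "support_list (\<sigma> t) = pull (snd (x t)) (support_list (\<sigma> (Suc t)))" for t
      unfolding \<sigma> using D(3) ED(3) by blast+
    have "size (\<sigma> t) = b" for t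
      using parts_in_ord_parts[of "\<sigma> t"] D(2)[of t] by (simp add: \<sigma> ord_parts_def)
    moreover have "\<sigma> (t + d) = \<sigma> t" for t
      by (rule parts_inject) (simp_all add: \<sigma> perE D(1))
    ultimately have "\<sigma> \<in> landing_seqs b d"
      using card_imp_landing_step[OF c] by (simp add: landing_seqs_def)
    moreover have "card_seq \<sigma> = x"
      using card_seq_eqI[where \<sigma> = \<sigma>, OF c] by (simp add: fun_eq_iff \<sigma>)
    ultimately show "x \<in> card_seq ` landing_seqs b d" by blast
  qed (use card_seq_closed_walk landing_times_not_top_fixed in blast)
qed

text \<open>The additive form avoids truncated subtraction of traces in \<open>nat\<close>.\<close>

lemma card_landing_seqs_trA:
  assumes d: "d \<ge> 1"
  shows "finite (landing_seqs b d)"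
    and "card (landing_seqs b d) + (\<Sum>i<b. trA i d) = trA b d"
proof -
  let ?X = "card_cycles b d"
  have fin: "finite ?X" by (rule trA_eq_card[OF d])
  then show "finite (landing_seqs b d)"
    using bij_betw_finite[OF bij_betw_card_seq[OF d]] by simp
  have "card ?X = card {x \<in> ?X. \<not> top_fixed x} + card {x \<in> ?X. top_fixed x}"
    using fin by (subst card_Un_disjoint[symmetric]) (auto intro: arg_cong[where f = card])
  then show "card (landing_seqs b d) + (\<Sum>i<b. trA i d) = trA b d"
    using bij_betw_same_card[OF bij_betw_card_seq[OF d]] card_top_fixed[OF d] trA_eq_card(2)[OF d]
    by metis
qed

theorem theorem8:
  fixes b n :: nat
  assumes "1 \<le> n"
  shows "real (jp b n) =
    (1 / real n) * (\<Sum>d\<in>{d. d dvd n}. real_of_int (moebius (n div d)) *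
        (real (trA b d) - (\<Sum>i<b. real (trA i d))))"
proof -
  define f where "f d = real (trA b d) - (\<Sum>i<b. real (trA i d))" for d
  have "f m = (\<Sum>d | d dvd m. real (card (primitive_seqs b d)))" if m: "m \<ge> 1" for m
  proof -
    have "f m = real (card (landing_seqs b m))"
      using card_landing_seqs_trA(2)[OF m, of b] by (simp add: f_def flip: of_nat_sum)
    then show ?thesis by (simp add: card_landing_seqs[OF m card_landing_seqs_trA(1)[OF m]])
  qed
  then have "real (card (primitive_seqs b n)) = (\<Sum>d | d dvd n. real_of_int (moebius (n div d)) * f d)"
    by (intro moebius_inversion[OF assms])
  moreover have "real (card (primitive_seqs b n)) = real n * real (jp b n)"
    using card_primitive_seqs[OF assms card_landing_seqs_trA(1)[OF assms], of b]
    by (simp flip: of_nat_mult)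
  ultimately show ?thesis using assms by (simp add: f_def field_simps)
qed

end
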